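(* Let $q\geq 3$ be an integer and $p\in(0,1)$, let $(Z_n)_{n\ge 0}$ be the lamplighter random walk on $\mathcal{L}_q=(\mathbb{Z}/2)\wr\mathcal{T}_q$ described in the context, and let $\ell=\lim_{n\to\infty}\ell(Z_n)/n$ be its rate of escape. Then $$\ell\ \geq\ \frac{(1-p)(q-2)}{q}\cdot\frac{q-2+2p(q+1)}{pq+q-2}$$ and $$\ell\ \leq\ \frac{(1-p)(q-2)}{q}\Bigl(\frac{q+1}{q-1}-\frac{2q}{q-1}\,\widehat\nu_2+\frac{pq}{pq+q-2}\Bigr),$$ where $$\widehat\nu_2=\frac{\widehat G}{1-\widehat G^2p^2}\cdot\frac{(1-p)(q-2)}{q(q-1)},\qquad \widehat G=\frac{2(q-1)}{q-2+\sqrt{q^2-4(q-1)(1-p)^2}}.$$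
   Context: Let $\mathcal{S}=\{a_1,\dots,a_q\}$ and let $\mathcal{T}_q$ be the free product of $q$ copies of $\mathbb{Z}/2$ generated by the $a_i$ (so $a_i^{-1}=a_i$); its elements are the finite words over $\mathcal{S}$ with no two equal consecutive letters, the identity is the empty word $o$, and its Cayley graph with respect to $\mathcal{S}$ is the homogeneous tree of degree $q$. $\mathcal{N}$ is the set of finitely supported functions $\eta:\mathcal{T}_q\to\mathbb{Z}/2=\{0,1\}$ (lamp configurations), $\mathbf{0}$ is the zero function, $\mathbf{1}_o$ is the indicator function of $\{o\}$, and $(x\eta)(w):=\eta(x^{-1}w)$. The group $\mathcal{L}_q=(\mathbb{Z}/2)\wr\mathcal{T}_q$ is the set $\mathcal{N}\times\mathcal{T}_q$ with the product $(\eta_1,x)(\eta_2,y)=(\eta_1\oplus x\eta_2,\,xy)$, where $\oplus$ is pointwise addition mod 2; its identity is $(\mathbf{0},o)$. Let $\mathcal{S}_{\mathcal{L}_q}=\{(\mathbf{1}_o,o)\}\cup\{(\mathbf{0},a):a\in\mathcal{S}\}$. For $(\eta,x)\in\mathcal{L}_q$, $\ell((\eta,x))$ is the length of a shortest path from $(\eta,x)$ to $(\mathbf{0},o)$ in the Cayley graph of $\mathcal{L}_q$ with respect to $\mathcal{S}_{\mathcal{L}_q}$ (edges $g\sim gs$). Random walk: $\mathbf{i}_1,\mathbf{i}_2,\dots$ are i.i.d. $\mathcal{L}_q$-valued with law $\mu$, where $\mu((\mathbf{1}_o,o))=p$ and $\mu((\mathbf{0},a))=(1-p)/q$ for each $a\in\mathcal{S}$;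 $Z_0=(\mathbf{0},o)$ and $Z_n=Z_{n-1}\mathbf{i}_n$. The rate of escape $\ell=\lim_{n\to\infty}\ell(Z_n)/n$ exists almost surely and is almost surely constant (Kingman's subadditive ergodic theorem). *)

theory Defs
  imports "HOL-Probability.Probability" "HOL-Algebra.Group" "HOL-Library.Z2"
begin

section \<open>The free product of \<open>q\<close> copies of \<open>\<int>/2\<close>\<close>

text \<open>
  The letters \<open>a\<^sub>1, \<dots>, a\<^sub>q\<close> are encoded as the natural numbers below \<open>q\<close>; group elements are
  the words without equal consecutive letters.
\<close>

definition reduced_words :: "nat \<Rightarrow> nat list set" where
  "reduced_words q = {w. set w \<subseteq> {..<q} \<and> distinct_adj w}"

fun letter_mult :: "nat \<Rightarrow> nat list \<Rightarrow> nat list" where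
  "letter_mult a [] = [a]"
| "letter_mult a (b # w) = (if a = b then w else a # b # w)"

definition word_mult :: "nat list \<Rightarrow> nat list \<Rightarrow> nat list" where
  "word_mult x y = foldr letter_mult x y"

definition tree_group :: "nat \<Rightarrow> nat list monoid" where
  "tree_group q = \<lparr>carrier = reduced_words q, mult = word_mult, one = []\<rparr>"

lemma letter_mult_reduced:
  assumes "a < q" "w \<in> reduced_words q"
  shows "letter_mult a w \<in> reduced_words q"
  using assms by (cases w rule: remdups_adj.cases) (auto simp: reduced_words_def)

lemma letter_mult_twice: "distinct_adj w \<Longrightarrow> letter_mult a (letter_mult a w) = w"
  by (cases w rule: remdups_adj.cases) auto

lemma word_mult_reduced:
  assumes "set x \<subseteq> {..<q}" "y \<in> reduced_words q"
  shows "word_mult x y \<in> reduced_words q"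
  using assms by (induction x) (auto simp: word_mult_def intro: letter_mult_reduced)

lemma word_mult_letter_mult:
  assumes "set u \<subseteq> {..<q}" "z \<in> reduced_words q"
  shows "word_mult (letter_mult a u) z = letter_mult a (word_mult u z)"
proof (cases u)
  case (Cons b v)
  have "distinct_adj (word_mult v z)"
    using word_mult_reduced[of v q z] assms Cons by (auto simp: reduced_words_def)
  then show ?thesis
    using Cons by (auto simp: word_mult_def letter_mult_twice)
qed (simp add: word_mult_def)

lemma word_mult_assoc:
  assumes "x \<in> reduced_words q" "y \<in> reduced_words q" "z \<in> reduced_words q"
  shows "word_mult (word_mult x y) z = word_mult x (word_mult y z)"
proof -
  have "set x \<subseteq> {..<q}"
    using assms by (simp add: reduced_words_def)
  then show ?thesis
  proof (induction x)
    case (Cons a x)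
    have "set (word_mult x y) \<subseteq> {..<q}"
      using word_mult_reduced[of x q y] Cons.prems assms by (auto simp: reduced_words_def)
    from word_mult_letter_mult[OF this assms(3)] show ?case
      using Cons by (simp add: word_mult_def)
  qed (simp add: word_mult_def)
qed

lemma word_mult_Nil_right: "distinct_adj x \<Longrightarrow> word_mult x [] = x"
proof (induction x)
  case (Cons a x)
  then show ?case
    by (cases x) (auto simp: word_mult_def)
qed (simp add: word_mult_def)

lemma word_mult_rev_left: "word_mult (rev x) x = []"
  by (induction x) (auto simp: word_mult_def)

lemma rev_reduced: "x \<in> reduced_words q \<Longrightarrow> rev x \<in> reduced_words q"
  by (simp add: reduced_words_def)

lemma group_tree_group: "group (tree_group q)"
proof (rule groupI)
  show "\<exists>y\<in>carrier (tree_group q). y \<otimes>\<^bsub>tree_group q\<^esub> x = \<one>\<^bsub>tree_group q\<^esub>"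
    if "x \<in> carrier (tree_group q)" for x
    using that word_mult_rev_left[of x] rev_reduced[of x q] by (auto simp: tree_group_def)
next
  show "x \<otimes>\<^bsub>tree_group q\<^esub> y \<in> carrier (tree_group q)"
    if "x \<in> carrier (tree_group q)" "y \<in> carrier (tree_group q)" for x y
    using that word_mult_reduced[of x q y] by (auto simp: tree_group_def reduced_words_def)
qed (auto simp: tree_group_def word_mult_assoc, auto simp: word_mult_def reduced_words_def)

section \<open>The wreath product with \<open>\<int>/2\<close>\<close>

text \<open>
  Lamp configurations are functions on the whole type that vanish outside the carrier of the
  base group, so that pointwise equality on the carrier is equality.
\<close>

definition lamp_configs :: "('a, 'b) monoid_scheme \<Rightarrow> ('a \<Rightarrow> bit) set" where
  "lamp_configs G = {\<eta>. finite {w. \<eta> w \<noteq> 0} \<and> {w. \<eta> w \<noteq> 0} \<subseteq> carrier G}"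

definition translate :: "('a, 'b) monoid_scheme \<Rightarrow> 'a \<Rightarrow> ('a \<Rightarrow> bit) \<Rightarrow> 'a \<Rightarrow> bit" where
  "translate G x \<eta> w = (if w \<in> carrier G then \<eta> (inv\<^bsub>G\<^esub> x \<otimes>\<^bsub>G\<^esub> w) else 0)"

definition lamplighter :: "('a, 'b) monoid_scheme \<Rightarrow> (('a \<Rightarrow> bit) \<times> 'a) monoid" where
  "lamplighter G =
    \<lparr>carrier = lamp_configs G \<times> carrier G,
     mult = (\<lambda>(\<eta>\<^sub>1, x) (\<eta>\<^sub>2, y). (\<lambda>w. \<eta>\<^sub>1 w + translate G x \<eta>\<^sub>2 w, x \<otimes>\<^bsub>G\<^esub> y)),
     one = (\<lambda>_. 0, \<one>\<^bsub>G\<^esub>)\<rparr>"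

lemma translate_lamp_configs:
  assumes "group G" "x \<in> carrier G" "\<eta> \<in> lamp_configs G"
  shows "translate G x \<eta> \<in> lamp_configs G"
proof -
  interpret group G by fact
  have "w \<in> (\<lambda>v. x \<otimes>\<^bsub>G\<^esub> v) ` {v. \<eta> v \<noteq> 0}" if "translate G x \<eta> w \<noteq> 0" for w
  proof (rule image_eqI)
    show "w = x \<otimes>\<^bsub>G\<^esub> (inv\<^bsub>G\<^esub> x \<otimes>\<^bsub>G\<^esub> w)"
      using that assms(2) by (auto simp: translate_def m_assoc[symmetric] split: if_splits)
    show "inv\<^bsub>G\<^esub> x \<otimes>\<^bsub>G\<^esub> w \<in> {v. \<eta> v \<noteq> 0}"
      using that by (auto simp: translate_def split: if_splits)
  qed
  then have "{w. translate G x \<eta> w \<noteq> 0} \<subseteq> (\<lambda>v. x \<otimes>\<^bsub>G\<^esub> v) ` {v. \<eta> v \<noteq> 0}"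
    by blast
  moreover have "finite ((\<lambda>v. x \<otimes>\<^bsub>G\<^esub> v) ` {v. \<eta> v \<noteq> 0})"
    using assms(3) by (simp add: lamp_configs_def)
  ultimately have "finite {w. translate G x \<eta> w \<noteq> 0}"
    by (rule finite_subset)
  then show ?thesis
    by (auto simp: lamp_configs_def translate_def split: if_splits)
qed

lemma add_lamp_configs:
  assumes "\<eta> \<in> lamp_configs G" "\<theta> \<in> lamp_configs G"
  shows "(\<lambda>w. \<eta> w + \<theta> w) \<in> lamp_configs G"
proof -
  have "{w. \<eta> w + \<theta> w \<noteq> 0} \<subseteq> {w. \<eta> w \<noteq> 0} \<union> {w. \<theta> w \<noteq> 0}"
    by auto
  moreover have "finite ({w. \<eta> w \<noteq> 0} \<union> {w. \<theta> w \<noteq> 0})"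
    using assms unfolding lamp_configs_def by blast
  moreover have "{w. \<eta> w \<noteq> 0} \<union> {w. \<theta> w \<noteq> 0} \<subseteq> carrier G"
    using assms unfolding lamp_configs_def by blast
  ultimately show ?thesis
    unfolding lamp_configs_def by (blast intro: finite_subset)
qed

lemma translate_add:
  "translate G x (\<lambda>w. \<eta> w + \<theta> w) = (\<lambda>w. translate G x \<eta> w + translate G x \<theta> w)"
  by (auto simp: translate_def)

lemma translate_translate:
  assumes "group G" "x \<in> carrier G" "y \<in> carrier G"
  shows "translate G x (translate G y \<eta>) = translate G (x \<otimes>\<^bsub>G\<^esub> y) \<eta>"
proof -
  interpret group G by fact
  show ?thesis
    using assms(2,3) by (auto simp: translate_def inv_mult_group m_assoc)
qed

lemma translate_one:
  assumes "group G" "\<eta> \<in> lamp_configs G"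
  shows "translate G \<one>\<^bsub>G\<^esub> \<eta> = \<eta>"
proof -
  interpret group G by fact
  have "\<eta> w = 0" if "w \<notin> carrier G" for w
    using assms(2) that unfolding lamp_configs_def by blast
  then show ?thesis
    by (auto simp: translate_def fun_eq_iff)
qed

lemma group_lamplighter:
  assumes "group G"
  shows "group (lamplighter G)"
proof -
  interpret group G by fact
  show ?thesis
  proof (rule groupI)
    fix g assume g: "g \<in> carrier (lamplighter G)"
    obtain \<eta> x where [simp]: "g = (\<eta>, x)" by force
    have x: "x \<in> carrier G" and \<eta>: "\<eta> \<in> lamp_configs G"
      using g by (auto simp: lamplighter_def)
    show "\<one>\<^bsub>lamplighter G\<^esub> \<otimes>\<^bsub>lamplighter G\<^esub> g = g"
    proof -
      have "(\<lambda>w. 0 + \<eta> w) = \<eta>"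
        by (simp only: add_0_left)
      then show ?thesis
        using x \<eta> by (simp add: lamplighter_def translate_one[OF assms] del: add_bit_eq_xor)
    qed
    show "\<exists>h\<in>carrier (lamplighter G). h \<otimes>\<^bsub>lamplighter G\<^esub> g = \<one>\<^bsub>lamplighter G\<^esub>"
    proof
      show "(translate G (inv\<^bsub>G\<^esub> x) \<eta>, inv\<^bsub>G\<^esub> x) \<in> carrier (lamplighter G)"
        using x \<eta> by (simp add: lamplighter_def translate_lamp_configs[OF assms])
      show "(translate G (inv\<^bsub>G\<^esub> x) \<eta>, inv\<^bsub>G\<^esub> x) \<otimes>\<^bsub>lamplighter G\<^esub> g = \<one>\<^bsub>lamplighter G\<^esub>"
      proof -
        have "b + b = 0" for b :: bit
          by (cases b) simp_all
        then show ?thesis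
          using x by (simp add: lamplighter_def del: add_bit_eq_xor)
      qed
    qed
  next
    fix g h assume "g \<in> carrier (lamplighter G)" "h \<in> carrier (lamplighter G)"
    then show "g \<otimes>\<^bsub>lamplighter G\<^esub> h \<in> carrier (lamplighter G)"
      by (auto simp: lamplighter_def translate_lamp_configs[OF assms] intro!: add_lamp_configs
          simp del: add_bit_eq_xor)
  next
    show "\<one>\<^bsub>lamplighter G\<^esub> \<in> carrier (lamplighter G)"
      by (simp add: lamplighter_def lamp_configs_def)
  next
    fix g h k
    assume "g \<in> carrier (lamplighter G)" "h \<in> carrier (lamplighter G)" "k \<in> carrier (lamplighter G)"
    then show "g \<otimes>\<^bsub>lamplighter G\<^esub> h \<otimes>\<^bsub>lamplighter G\<^esub> k =
        g \<otimes>\<^bsub>lamplighter G\<^esub> (h \<otimes>\<^bsub>lamplighter G\<^esub> k)"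
      by (auto simp: lamplighter_def translate_add translate_translate[OF assms] m_assoc
          add.assoc simp del: add_bit_eq_xor)
  qed
qed

section \<open>Cayley graphs and word length\<close>

definition cayley_edges :: "('a, 'b) monoid_scheme \<Rightarrow> 'a set \<Rightarrow> ('a \<times> 'a) set" where
  "cayley_edges G S =
    (let E = {(g, g \<otimes>\<^bsub>G\<^esub> s) | g s. g \<in> carrier G \<and> s \<in> S} in E \<union> E\<inverse>)"

definition cayley_length :: "('a, 'b) monoid_scheme \<Rightarrow> 'a set \<Rightarrow> 'a \<Rightarrow> nat" where
  "cayley_length G S g = (LEAST n. (g, \<one>\<^bsub>G\<^esub>) \<in> cayley_edges G S ^^ n)"

section \<open>The lamplighter random walk\<close>

type_synonym lamplighter_state = "(nat list \<Rightarrow> bit) \<times> nat list"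

definition tree_lamplighter :: "nat \<Rightarrow> lamplighter_state monoid" where
  "tree_lamplighter q = lamplighter (tree_group q)"

definition switch :: lamplighter_state where
  "switch = ((\<lambda>w. if w = [] then 1 else 0), [])"

definition moves :: "nat \<Rightarrow> lamplighter_state set" where
  "moves q = {((\<lambda>_. 0), [a]) | a. a < q}"

definition lamplighter_length :: "nat \<Rightarrow> lamplighter_state \<Rightarrow> nat" where
  "lamplighter_length q = cayley_length (tree_lamplighter q) (insert switch (moves q))"

definition step_law :: "nat \<Rightarrow> real \<Rightarrow> lamplighter_state \<Rightarrow> real" where
  "step_law q p g =
    (if g = switch then p else if g \<in> moves q then (1 - p) / real q else 0)"

text \<open>The increments are indexed from 1: the value \<open>X 0\<close> is never used.\<close>

primrec random_walk :: "('a, 'b) monoid_scheme \<Rightarrow> (nat \<Rightarrow> 'w \<Rightarrow> 'a) \<Rightarrow> nat \<Rightarrow> 'w \<Rightarrow> 'a" where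
  "random_walk G X 0 \<omega> = \<one>\<^bsub>G\<^esub>"
| "random_walk G X (Suc n) \<omega> = random_walk G X n \<omega> \<otimes>\<^bsub>G\<^esub> X (Suc n) \<omega>"

definition G_hat :: "nat \<Rightarrow> real \<Rightarrow> real" where
  "G_hat q p =
    2 * (real q - 1) / (real q - 2 + sqrt ((real q)\<^sup>2 - 4 * (real q - 1) * (1 - p)\<^sup>2))"

definition nu2_hat :: "nat \<Rightarrow> real \<Rightarrow> real" where
  "nu2_hat q p =
    G_hat q p / (1 - (G_hat q p)\<^sup>2 * p\<^sup>2) *
      ((1 - p) * (real q - 2) / (real q * (real q - 1)))"

end

theory Submission
  imports Defs "HOL-Library.Sublist"
begin

text \<open>
  Word length is at most the number of increments, so by dominated convergence the almost sure
  rate of escape is the limit of \<open>E \<ell>(Z\<^sub>n) / n\<close>, and this expectation is a finite sum over lists of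
  \<open>n\<close> increments (\<open>rate_as_limit_of_expectations\<close>).  It remains to bound that sum up to an error
  bounded in \<open>n\<close>.

  Let the walker stand at \<open>x\<close> and let \<open>S\<close> be the set of lit lamps.  A shortest word performs a tour
  from \<open>o\<close> to \<open>x\<close> through \<open>S\<close>: it crosses the geodesic from \<open>o\<close> to \<open>x\<close> once, every other edge of the
  subtree spanned by \<open>o\<close>, \<open>x\<close> and \<open>S\<close> twice, and switches \<open>|S|\<close> times.  Each lit lamp off the geodesic
  owns the edge above it, which gives the lower estimate \<open>|x| + |S| + 2 |S - [o,x]|\<close>
  (\<open>length_ge\<close>); the upper estimate counts all vertices off the geodesic that have a lit lamp in
  the branch behind them (\<open>length_upper\<close>).

  The increments are i.i.d., so a new increment may as well be put in front of the others.  The effect is to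
  move the origin by at most one letter, and the expected changes of \<open>|x|\<close>, \<open>|S|\<close> and
  \<open>|S \<inter> [o,x]|\<close> become probabilities about the lamps at \<open>o\<close> and its neighbours and about the branch in
  which the walk ends.  Written in terms of the vertex \<open>v\<close> as seen from the walker, such
  probabilities obey first-step recursions whose fixed points are built from \<open>F^|v|\<close>, where
  \<open>F = 1/(q-1)\<close> is the probability of ever hitting a given neighbour.  The distance to the fixed
  point is at most \<open>\<rho>^|v|\<close> at time \<open>0\<close>, with \<open>\<rho> = (q-1)^(-1/2)\<close>, and the averaging step contracts
  \<open>\<rho>^|v|\<close> by a factor below \<open>1\<close> (\<open>decay\<close>).  Hence all errors are geometric in time and summable.

  For the upper bound, a vertex \<open>y\<close> off the geodesic with a lit lamp behind it has been visited; the
  walk is cut at its first visit.  Reversed in time, the past is a walk that does not return to its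
  start.  The future has to end in the branch of the parent of \<open>y\<close>, which has limiting probability
  \<open>1/q\<close>, but must not \<^emph>\<open>clear\<close> \<open>y\<close>: switch only at \<open>y\<close>, an even number of times, before it leaves
  \<open>y\<close> towards the parent for ever.  The probability of clearing \<open>y\<close> is asymptotically at least
  \<open>nu2_hat\<close> (\<open>cleared_limit\<close>): between switches the walk makes loops without switching, whose total
  weight is the Green function \<open>G\<close> at \<open>1 - p\<close>, the sum over an even number of switches is
  \<open>G / (1 - G\<^sup>2 p\<^sup>2)\<close>, and the final exit contributes the remaining factor.
\<close>

section \<open>Finite walks seen from a target vertex\<close>

text \<open>
  A finite walk is the list of its increments, \<open>None\<close> for a switch and \<open>Some a\<close> for a move.  Apart from
  \<open>pos\<close>, the functions below read the list from the front and carry a vertex \<open>v\<close>: the target as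
  seen from the walker, that is \<open>x\<inverse> y\<close> for a walker at \<open>x\<close> and a target \<open>y\<close>.  Thus removing the head of
  the list is the first-step decomposition, and the walker is at the target when \<open>v = []\<close>.  Because the
  letters are involutions, a move by \<open>a\<close> multiplies \<open>v\<close> by \<open>a\<close> from the left.
\<close>

fun step :: "nat option \<Rightarrow> nat list \<Rightarrow> nat list" where
  "step None v = v"
| "step (Some a) v = letter_mult a v"

primrec pos :: "nat option list \<Rightarrow> nat list" where
  "pos [] = []"
| "pos (x # s) = step x (pos s)"

primrec rel :: "nat option list \<Rightarrow> nat list \<Rightarrow> nat list" where
  "rel [] v = v"
| "rel (x # s) v = rel s (step x v)"

primrec lit :: "nat option list \<Rightarrow> nat list \<Rightarrow> bool" where
  "lit [] v = False"
| "lit (x # s) v = ((x = None \<and> v = []) \<noteq> lit s (step x v))"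

primrec avoid :: "nat option list \<Rightarrow> nat list \<Rightarrow> bool" where
  "avoid [] v = (v \<noteq> [])"
| "avoid (x # s) v = (v \<noteq> [] \<and> avoid s (step x v))"

text \<open>
  The target is left for ever through the letter \<open>a\<close>, and up to that moment lamps are switched only at
  the target, with total parity \<open>\<sigma>\<close>.  This is the event behind \<open>nu2_hat\<close>.
\<close>

primrec cleared :: "nat \<Rightarrow> nat option list \<Rightarrow> nat list \<Rightarrow> bool \<Rightarrow> bool" where
  "cleared a [] v \<sigma> = False"
| "cleared a (x # s) v \<sigma> = (case x of
     None \<Rightarrow> v = [] \<and> cleared a s [] (\<not> \<sigma>)
   | Some b \<Rightarrow> cleared a s (letter_mult b v) \<sigma> \<or> (v = [] \<and> b = a \<and> \<not> \<sigma> \<and> avoid s [a]))"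

definition letters :: "nat \<Rightarrow> nat option set" where
  "letters q = insert None (Some ` {..<q})"

text \<open>
  Applied to a target as seen from the walker, this says that the walker sits in the branch that hangs on the
  target by the letter \<open>a\<close>.
\<close>

abbreviation ends_at :: "nat \<Rightarrow> nat list \<Rightarrow> bool" where
  "ends_at a v \<equiv> v \<noteq> [] \<and> last v = a"

lemma Nil_reduced [simp]: "[] \<in> reduced_words q"
  by (simp add: reduced_words_def)

lemma reduced_singleton [simp]: "[a] \<in> reduced_words q \<longleftrightarrow> a < q"
  by (simp add: reduced_words_def)

lemma step_reduced: "x \<in> letters q \<Longrightarrow> v \<in> reduced_words q \<Longrightarrow> step x v \<in> reduced_words q"
  by (auto simp: letters_def letter_mult_reduced)

lemma step_step: "v \<in> reduced_words q \<Longrightarrow> step x (step x v) = v"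
  by (cases x) (auto simp: letter_mult_twice reduced_words_def)

lemma rel_reduced:
  "set s \<subseteq> letters q \<Longrightarrow> v \<in> reduced_words q \<Longrightarrow> rel s v \<in> reduced_words q"
  by (induction s arbitrary: v) (auto simp: step_reduced)

lemma pos_reduced: "set s \<subseteq> letters q \<Longrightarrow> pos s \<in> reduced_words q"
  by (induction s) (auto simp: step_reduced)

lemma rel_append: "rel (s @ t) v = rel t (rel s v)"
  by (induction s arbitrary: v) auto

lemma lit_append: "lit (s @ t) v = (lit s v \<noteq> lit t (rel s v))"
  by (induction s arbitrary: v) auto

lemma word_mult_Cons: "word_mult (a # u) v = letter_mult a (word_mult u v)"
  by (simp add: word_mult_def)

lemma word_mult_Nil [simp]: "word_mult [] v = v"
  by (simp add: word_mult_def)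

lemma word_mult_append: "word_mult (u @ w) v = word_mult u (word_mult w v)"
  by (simp add: word_mult_def)

text \<open>
  The target seen from the end of the walk is \<open>x\<inverse> y\<close>, and inversion in the free product is reversal of words.
\<close>

lemma rel_conv_pos:
  assumes "set s \<subseteq> letters q" "v \<in> reduced_words q"
  shows "rel s v = word_mult (rev (pos s)) v"
  using assms
proof (induction s arbitrary: v)
  case (Cons x s)
  have IH: "rel s (step x v) = word_mult (rev (pos s)) (step x v)"
    using Cons by (auto simp: step_reduced)
  show ?case
  proof (cases x)
    case (Some a)
    have "word_mult (rev (letter_mult a w)) v = word_mult (rev w) (letter_mult a v)" for w
      using Cons.prems
      by (cases w) (auto simp: word_mult_append word_mult_Cons letter_mult_twice reduced_words_def)
    then show ?thesis using IH Some by simp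
  qed (use IH in simp)
qed simp

lemma rel_Nil_conv: "set s \<subseteq> letters q \<Longrightarrow> rel s [] = rev (pos s)"
  using rel_conv_pos[of s q "[]"] word_mult_Nil_right[of "rev (pos s)"] pos_reduced[of s q]
  by (simp add: reduced_words_def)

lemma rel_rev:
  assumes "set s \<subseteq> letters q" "v \<in> reduced_words q"
  shows "rel (rev s) (rel s v) = v"
  using assms
proof (induction s arbitrary: v)
  case (Cons x s)
  then show ?case
    by (simp add: rel_append step_reduced step_step)
qed simp

lemma rel_inject:
  assumes "set s \<subseteq> letters q" "v \<in> reduced_words q" "w \<in> reduced_words q"
  shows "rel s v = rel s w \<longleftrightarrow> v = w"
  using rel_rev[of s q v] rel_rev[of s q w] assms by metis

lemma rel_pos: "set s \<subseteq> letters q \<Longrightarrow> rel s (pos s) = []"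
  using rel_conv_pos[of s q "pos s"] word_mult_rev_left[of "pos s"] pos_reduced[of s q] by simp

lemma rel_eq_Nil_iff:
  "set s \<subseteq> letters q \<Longrightarrow> v \<in> reduced_words q \<Longrightarrow> rel s v = [] \<longleftrightarrow> v = pos s"
  using rel_inject[of s q v "pos s"] rel_pos[of s q] pos_reduced[of s q] by auto

lemma letter_mult_append: "v \<noteq> [] \<Longrightarrow> letter_mult a (v @ t) = letter_mult a v @ t"
  by (cases v) auto

lemma last_letter_mult:
  "v \<noteq> [] \<Longrightarrow> letter_mult a v \<noteq> [] \<Longrightarrow> last (letter_mult a v) = last v"
  by (cases v) auto

lemma avoid_not_Nil: "avoid s v \<Longrightarrow> v \<noteq> []"
  by (cases s) auto

text \<open>
  This is where the tree enters: a walk that has not reached the target is still in the branch in which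
  it started, so it has touched nothing behind the target.  The vertices behind it are \<open>v @ t\<close>.
\<close>

lemma avoid_behind:
  assumes "avoid s v"
  shows "rel s v \<noteq> [] \<and> last (rel s v) = last v \<and> \<not> lit s (v @ t) \<and> rel s (v @ t) = rel s v @ t"
  using assms
proof (induction s arbitrary: v)
  case (Cons x s)
  show ?case
  proof (cases x)
    case None
    then show ?thesis using Cons by auto
  next
    case (Some a)
    have "avoid s (letter_mult a v)" "v \<noteq> []"
      using Cons.prems Some by auto
    moreover from this(1) have "letter_mult a v \<noteq> []" by (rule avoid_not_Nil)
    ultimately show ?thesis
      using Cons.IH[of "letter_mult a v"] Some by (simp add: letter_mult_append last_letter_mult)
  qed
qed auto

lemma avoid_iff: "avoid s v \<longleftrightarrow> (\<forall>u w. s = u @ w \<longrightarrow> rel u v \<noteq> [])"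
proof (induction s arbitrary: v)
  case (Cons x s)
  have "(\<forall>u w. x # s = u @ w \<longrightarrow> rel u v \<noteq> []) \<longleftrightarrow>
    v \<noteq> [] \<and> (\<forall>u w. s = u @ w \<longrightarrow> rel (x # u) v \<noteq> [])"
    unfolding Cons_eq_append_conv by (metis rel.simps(1))
  then show ?case
    using Cons.IH by simp
qed simp

text \<open>
  Time reversal: the letters are involutions, so the reversed list runs through the same vertices backwards.
\<close>

lemma avoid_rev:
  assumes "set s \<subseteq> letters q" "v \<in> reduced_words q" "avoid s v"
  shows "avoid (rev s) (rel s v)"
  unfolding avoid_iff
proof (intro allI impI)
  fix u w assume "rev s = u @ w"
  then have s: "s = rev w @ rev u" by (metis rev_append rev_rev_ident)
  have "rel u (rel s v) = rel u (rel (rev u) (rel (rev w) v))"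
    by (simp add: s rel_append)
  also have "\<dots> = rel (rev w) v"
    using rel_rev[of "rev u" q "rel (rev w) v"] assms(1,2) rel_reduced[of "rev w" q v]
    by (simp add: s)
  finally show "rel u (rel s v) \<noteq> []"
    using assms(3) unfolding avoid_iff s by auto
qed

lemma first_visit:
  assumes "\<not> avoid s v" "v \<noteq> []"
  shows "\<exists>s1 a s2. s = s1 @ Some a # s2 \<and> avoid s1 v \<and> rel s1 v = [a]"
  using assms
proof (induction s arbitrary: v)
  case (Cons x s)
  show ?case
  proof (cases "step x v = []")
    case True
    then obtain a where a: "x = Some a" "letter_mult a v = []"
      using Cons.prems by (cases x) auto
    then have "v = [a]"
      using Cons.prems by (cases v) (auto split: if_splits)
    then show ?thesis
      using a by (intro exI[of _ "[]"] exI[of _ a] exI[of _ s]) auto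
  next
    case False
    obtain s1 a s2 where "s = s1 @ Some a # s2 \<and> avoid s1 (step x v) \<and> rel s1 (step x v) = [a]"
      using Cons.IH[of "step x v"] Cons.prems False by auto
    then show ?thesis
      using Cons.prems by (intro exI[of _ "x # s1"] exI[of _ a] exI[of _ s2]) auto
  qed
qed simp

lemma cleared_imp_visit: "cleared a s v \<sigma> \<Longrightarrow> \<not> avoid s v"
  by (induction s arbitrary: v \<sigma>) (auto split: option.splits)

text \<open>
  The vertices behind the target, for a walk that finally leaves through \<open>a\<close>, are reached from the
  target by words \<open>t\<close> not starting with \<open>a\<close>.  Before the exit only the target's own lamp is switched, and
  after it the walk stays on the other side.
\<close>

lemma cleared_lit:
  assumes "cleared a s v \<sigma>" "set s \<subseteq> letters q" "v \<in> reduced_words q" "t \<in> reduced_words q"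
    and "t = [] \<or> hd t \<noteq> a"
  shows "lit s (word_mult v t) \<longleftrightarrow> t = [] \<and> \<sigma>"
  using assms(1-3)
proof (induction s arbitrary: v \<sigma>)
  case (Cons x s)
  show ?case
  proof (cases x)
    case None
    then have "v = []" "cleared a s [] (\<not> \<sigma>)" using Cons.prems by auto
    then show ?thesis using Cons.IH[of "[]" "\<not> \<sigma>"] Cons.prems None by auto
  next
    case (Some b)
    have b: "b < q" "set v \<subseteq> {..<q}"
      using Cons.prems Some by (auto simp: letters_def reduced_words_def)
    consider "cleared a s (letter_mult b v) \<sigma>" | "v = []" "b = a" "\<not> \<sigma>" "avoid s [a]"
      using Cons.prems Some by auto
    then show ?thesis
    proof cases
      case 1
      then show ?thesis
        using Cons.IH[OF 1] Cons.prems Some b word_mult_letter_mult[OF b(2) assms(4), of b]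
        by (simp add: letter_mult_reduced)
    next
      case 2
      have "letter_mult a t = [a] @ t"
        using assms(5) by (cases t) auto
      then show ?thesis
        using 2 Some avoid_behind[OF 2(4), of t] by simp
    qed
  qed
qed simp

lemma cleared_ends_at:
  assumes "cleared a s v \<sigma>"
  shows "ends_at a (rel s v)"
  using assms
proof (induction s arbitrary: v \<sigma>)
  case (Cons x s)
  then show ?case
    using avoid_behind[of s "[a]" "[]"] by (cases x) auto
qed simp

text \<open>
  If the geodesic to \<open>x\<close> does not pass through \<open>y\<close>, then the last letter of \<open>y\<close> does not cancel in
  \<open>x\<inverse> y\<close>: the walker at \<open>x\<close> sees \<open>y\<close> from the side of the parent of \<open>y\<close>.
\<close>

lemma not_prefix_ends_at:
  assumes "\<not> prefix y x" "distinct_adj x"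
  shows "ends_at (last y) (word_mult (rev x) y)"
  using assms
proof (induction x arbitrary: y)
  case Nil
  then show ?case by (cases y) auto
next
  case (Cons c x)
  obtain b y' where y: "y = b # y'" using Cons.prems by (cases y) auto
  show ?case
  proof (cases "b = c")
    case True
    then have "\<not> prefix y' x" "y' \<noteq> []" using Cons.prems y by auto
    then show ?thesis
      using Cons.IH[of y'] Cons.prems True y
      by (auto simp: word_mult_append word_mult_Cons distinct_adj_Cons)
  next
    case False
    have "\<not> prefix (c # y) x"
      using Cons.prems by (cases x) auto
    then show ?thesis
      using Cons.IH[of "c # y"] Cons.prems False y
      by (auto simp: word_mult_append word_mult_Cons distinct_adj_Cons)
  qed
qed

text \<open>
  A lit lamp behind \<open>y\<close> forces a visit of \<open>y\<close>.  Cutting the walk at the first one turns the statement that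
  \<open>y\<close> contributes to the upper bound into conditions on two independent pieces: the past, read backwards
  from \<open>y\<close>, and the future, read from \<open>y\<close>.
\<close>

lemma lit_branch_first_visit:
  assumes s: "set s \<subseteq> letters q" and y: "y \<in> reduced_words q" "\<not> prefix y (pos s)"
    and z: "z \<in> reduced_words q" "lit s z" "prefix y z"
  shows "\<exists>s1 a s2. s = s1 @ Some a # s2 \<and> y = pos (s1 @ [Some a]) \<and> a < q \<and>
    avoid (rev s1) [a] \<and> ends_at a (rel s2 []) \<and> \<not> cleared a s2 [] False"
proof -
  have "y \<noteq> []" using y by auto
  obtain t where zt: "z = y @ t" using z(3) by (auto simp: prefix_def)
  have "\<not> avoid s y" using avoid_behind[of s y t] z zt by auto
  from first_visit[OF this \<open>y \<noteq> []\<close>] obtain s1 a s2 where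
    dec: "s = s1 @ Some a # s2" "avoid s1 y" "rel s1 y = [a]" by blast
  have s12: "set s1 \<subseteq> letters q" "set s2 \<subseteq> letters q" "a < q"
    using s dec by (auto simp: letters_def)
  have last: "last y = a" using avoid_behind[OF dec(2), of "[]"] dec(3) by auto
  have s1a: "set (s1 @ [Some a]) \<subseteq> letters q" using s dec by auto
  have "rel (s1 @ [Some a]) y = []" using dec by (simp add: rel_append)
  then have ypos: "y = pos (s1 @ [Some a])"
    using rel_eq_Nil_iff[OF s1a y(1)] by blast
  have av: "avoid (rev s1) [a]"
    using avoid_rev[OF s12(1) y(1) dec(2)] dec(3) by simp
  have "rel s y = rel s2 []" using dec by (simp add: rel_append)
  then have ends: "ends_at a (rel s2 [])"
    using not_prefix_ends_at[OF y(2)] pos_reduced[OF s] last rel_conv_pos[OF s y(1)]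
    by (auto simp: reduced_words_def)
  have "\<not> cleared a s2 [] False"
  proof
    assume g: "cleared a s2 [] False"
    have t: "t \<in> reduced_words q" "t = [] \<or> hd t \<noteq> a"
      using z(1) last \<open>y \<noteq> []\<close>
      by (auto simp: zt reduced_words_def distinct_adj_append_iff)
    have "\<not> lit s2 t" using cleared_lit[OF g s12(2) _ t] by simp
    moreover have "lit s z = lit s2 t"
      using avoid_behind[OF dec(2), of t] dec by (simp add: zt lit_append)
    ultimately show False using z by simp
  qed
  then show ?thesis using dec s12 ypos av ends by blast
qed


section \<open>Expectations over finite walks\<close>

text \<open>
  A vertex of the tree other than the root has one neighbour closer to the root and \<open>q - 1\<close> farther away.
\<close>

lemma sum_letter_mult_length:
  fixes f :: "nat \<Rightarrow> real"
  assumes "v \<in> reduced_words q" "v \<noteq> []"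
  shows "(\<Sum>a<q. f (length (letter_mult a v))) =
    f (length v - 1) + (real q - 1) * f (length v + 1)"
proof -
  obtain b w where v: "v = b # w" using assms(2) by (cases v) auto
  have b: "b < q" using assms v by (auto simp: reduced_words_def)
  have "(\<Sum>a<q. f (length (letter_mult a v))) =
      f (length w) + (\<Sum>a\<in>{..<q} - {b}. f (length (letter_mult a v)))"
    using b v by (subst sum.remove[of _ b]) auto
  also have "(\<Sum>a\<in>{..<q} - {b}. f (length (letter_mult a v))) =
      (\<Sum>a\<in>{..<q} - {b}. f (length v + 1))"
    using v by (intro sum.cong) auto
  also have "\<dots> = (real q - 1) * f (length v + 1)"
    using b by (simp add: of_nat_diff)
  finally show ?thesis using v by simp
qed

lemma geometric_sum_le:
  fixes l :: real
  assumes "0 \<le> l" "l < 1"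
  shows "(\<Sum>i<n. l ^ i) \<le> 1 / (1 - l)"
proof -
  have "(\<Sum>i<n. l ^ i) = (1 - l ^ n) / (1 - l)"
    using assms by (simp add: sum_gp_strict)
  also have "\<dots> \<le> 1 / (1 - l)"
    using assms by (intro divide_right_mono) auto
  finally show ?thesis .
qed

lemma drift_bound:
  fixes x :: "nat \<Rightarrow> real"
  assumes "\<And>n. x (Suc n) \<le> x n + A + B * l ^ n" "0 \<le> l" "l < 1" "0 \<le> B"
  shows "x n \<le> x 0 + real n * A + B / (1 - l)"
proof -
  have "x n \<le> x 0 + real n * A + B * (\<Sum>i<n. l ^ i)"
  proof (induction n)
    case (Suc n)
    then show ?case using assms(1)[of n] by (simp add: algebra_simps)
  qed simp
  also have "(\<Sum>i<n. l ^ i) \<le> 1 / (1 - l)"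
    using assms by (intro geometric_sum_le)
  finally show ?thesis using assms(4)
    by (simp add: mult_left_mono)
qed

locale lamplighter_walk =
  fixes q :: nat and p :: real
  assumes q3: "q \<ge> 3" and p_pos: "0 < p" and p_less: "p < 1"
begin

definition move_prob :: real where "move_prob = (1 - p) / real q"

lemma move_prob_q: "move_prob * real q = 1 - p" and move_prob_pos: "0 < move_prob"
  using q3 p_less by (auto simp: move_prob_def)

text \<open>
  Since the weights do not depend on the position in the list, recursion at the head is as good as recursion at the
  end (\<open>expect_snoc\<close>).  The head is chosen because it matches the recursions of \<open>lit\<close>, \<open>rel\<close>, \<open>avoid\<close>
  and \<open>cleared\<close>.
\<close>

primrec expect :: "nat \<Rightarrow> (nat option list \<Rightarrow> real) \<Rightarrow> real" where
  "expect 0 f = f []"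
| "expect (Suc n) f = p * expect n (\<lambda>s. f (None # s)) +
     move_prob * (\<Sum>a<q. expect n (\<lambda>s. f (Some a # s)))"

lemma expect_add: "expect n (\<lambda>s. f s + g s) = expect n f + expect n g"
  by (induction n arbitrary: f g) (simp_all add: sum.distrib algebra_simps)

lemma expect_cmult: "expect n (\<lambda>s. c * f s) = c * expect n f"
  by (induction n arbitrary: f) (simp_all add: sum_distrib_left algebra_simps)

lemma expect_diff: "expect n (\<lambda>s. f s - g s) = expect n f - expect n g"
  using expect_add[of n f "\<lambda>s. - 1 * g s"] unfolding expect_cmult by simp

lemma expect_const: "expect n (\<lambda>_. c) = c"
  using move_prob_q by (induction n) (simp_all add: algebra_simps, metis distrib_left mult.commute diff_add_cancel mult.right_neutral mult.assoc)

lemma expect_sum: "expect n (\<lambda>s. \<Sum>i\<in>I. f i s) = (\<Sum>i\<in>I. expect n (f i))"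
  by (induction I rule: infinite_finite_induct) (simp_all add: expect_const expect_add)

lemma expect_mono:
  assumes "\<And>s. set s \<subseteq> letters q \<Longrightarrow> length s = n \<Longrightarrow> f s \<le> g s"
  shows "expect n f \<le> expect n g"
  using assms
proof (induction n arbitrary: f g)
  case (Suc n)
  have "expect n (\<lambda>s. f (x # s)) \<le> expect n (\<lambda>s. g (x # s))" if "x \<in> letters q" for x
    using that by (intro Suc.IH Suc.prems) auto
  then show ?case
    using p_pos move_prob_pos
    by (auto intro!: add_mono mult_left_mono sum_mono simp: letters_def)
qed simp

lemma expect_cong:
  assumes "\<And>s. set s \<subseteq> letters q \<Longrightarrow> length s = n \<Longrightarrow> f s = g s"
  shows "expect n f = expect n g"
  using assms by (intro antisym expect_mono) auto

lemma expect_snoc: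
  "expect (Suc n) f = p * expect n (\<lambda>s. f (s @ [None])) +
     move_prob * (\<Sum>a<q. expect n (\<lambda>s. f (s @ [Some a])))"
proof (induction n arbitrary: f)
  case (Suc n)
  have IH: "expect (Suc n) (\<lambda>s. f (x # s)) = p * expect n (\<lambda>s. f (x # s @ [None])) +
      move_prob * (\<Sum>b<q. expect n (\<lambda>s. f (x # s @ [Some b])))" for x
    using Suc.IH[of "\<lambda>s. f (x # s)"] unfolding append_Cons .
  have "(\<Sum>a<q. \<Sum>b<q. expect n (\<lambda>s. f (Some a # s @ [Some b]))) =
      (\<Sum>b<q. \<Sum>a<q. expect n (\<lambda>s. f (Some a # s @ [Some b])))"
    by (rule sum.swap)
  then have swap: "(\<Sum>a<q. move_prob * (\<Sum>b<q. expect n (\<lambda>s. f (Some a # s @ [Some b])))) =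
      (\<Sum>b<q. move_prob * (\<Sum>a<q. expect n (\<lambda>s. f (Some a # s @ [Some b]))))"
    unfolding sum_distrib_left[symmetric] by simp
  have "expect (Suc (Suc n)) f = p * expect (Suc n) (\<lambda>s. f (None # s)) +
      move_prob * (\<Sum>a<q. expect (Suc n) (\<lambda>s. f (Some a # s)))"
    by (rule expect.simps(2))
  also have "\<dots> = p * expect (Suc n) (\<lambda>s. f (s @ [None])) +
      move_prob * (\<Sum>b<q. expect (Suc n) (\<lambda>s. f (s @ [Some b])))"
    unfolding IH unfolding expect.simps(2) append_Cons sum.distrib swap
      sum_distrib_left[of p, symmetric] by (simp only: algebra_simps)
  finally show ?case .
qed simp

lemma expect_rev: "expect n (\<lambda>s. f (rev s)) = expect n f"
proof (induction n arbitrary: f)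
  case (Suc n)
  have "expect (Suc n) (\<lambda>s. f (rev s)) =
      p * expect n (\<lambda>s. f (rev s @ [None])) + move_prob * (\<Sum>a<q. expect n (\<lambda>s. f (rev s @ [Some a])))"
    by simp
  also have "\<dots> = expect (Suc n) f"
    unfolding expect_snoc Suc.IH[of "\<lambda>s. f (s @ [x])" for x] ..
  finally show ?case .
qed simp

text \<open>
  The Markov property at a fixed time: the letters before, at and after position \<open>k\<close> are independent.
\<close>

lemma expect_split:
  "expect (k + Suc m) (\<lambda>s. f (take k s) (s ! k) (drop (Suc k) s)) =
   expect k (\<lambda>s. p * expect m (f s None) + move_prob * (\<Sum>a<q. expect m (f s (Some a))))"
proof (induction k arbitrary: f)
  case (Suc k)
  have "expect (k + Suc m) (\<lambda>s. f (x # take k s) (s ! k) (drop (Suc k) s)) =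
      expect k (\<lambda>s. p * expect m (f (x # s) None) + move_prob * (\<Sum>a<q. expect m (f (x # s) (Some a))))" for x
    using Suc.IH[of "\<lambda>s. f (x # s)"] .
  then show ?case by simp
qed simp

section \<open>Contraction towards harmonic functions\<close>

text \<open>
  \<open>F\<close> is the probability of ever reaching a given neighbour.  The averaging operator of the tree has spectral radius
  \<open>2 sqrt (q - 1) / q\<close>, and \<open>rho^|v|\<close> with \<open>rho\<^sup>2 = F\<close> is a weight that one step, lazy with probability
  \<open>p\<close>, multiplies by at most \<open>lam\<close>.
\<close>

definition F :: real where "F = 1 / (real q - 1)"
definition rho :: real where "rho = 1 / sqrt (real q - 1)"
definition lam :: real where "lam = p + (1 - p) * (2 * sqrt (real q - 1) / q)"

lemma rho_pos: "0 < rho" and rho_less: "rho < 1" and F_eq: "F = rho ^ 2"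
  and F_pos: "0 < F" and F_less: "F < 1" and F_le_rho: "F \<le> rho"
proof -
  have q: "real q - 1 > 1" using q3 by simp
  then show 0: "0 < rho" and 1: "rho < 1" by (auto simp: rho_def)
  show 2: "F = rho ^ 2" using q by (simp add: F_def rho_def power_divide)
  show "0 < F" "F < 1" using q by (auto simp: F_def)
  show "F \<le> rho" using 0 1 unfolding 2 by (simp add: power2_eq_square mult_left_le)
qed

lemma lam_nonneg: "0 \<le> lam" and lam_less: "lam < 1"
proof -
  have q: "real q - 1 > 1" using q3 by simp
  define t where "t = sqrt (real q - 1)"
  have t: "t > 1" "real q = t ^ 2 + 1" using q by (auto simp: t_def)
  \<comment> \<open>The bound \<open>2 sqrt (q - 1) < q\<close>, strict because \<open>q - 1 > 1\<close>.\<close>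
  have "(t - 1) ^ 2 > 0" using t by simp
  then have "2 * t < real q" unfolding t(2) by (simp add: power2_eq_square algebra_simps)
  then have "2 * t / q < 1" using q by simp
  then have "(1 - p) * (2 * t / q) < (1 - p) * 1"
    using p_less by (intro mult_strict_left_mono) auto
  moreover have "p + x < 1" if "x < (1 - p) * 1" for x using that by simp
  ultimately show "lam < 1" unfolding lam_def t_def[symmetric] by blast
  show "0 \<le> lam" unfolding lam_def using q p_pos p_less by simp
qed

lemma neighbour_sum_rho:
  assumes "v \<in> reduced_words q"
  shows "p * rho ^ length v + move_prob * (\<Sum>a<q. rho ^ length (letter_mult a v))
    \<le> lam * rho ^ length v"
proof -
  define t where "t = sqrt (real q - 1)"
  have t: "t > 1" "real q = t ^ 2 + 1" "rho = 1 / t"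
    using q3 by (auto simp: t_def rho_def)
  have "(\<Sum>a<q. rho ^ length (letter_mult a v)) \<le> 2 * t * rho ^ length v"
  proof (cases "v = []")
    case True
    have "q * rho \<le> 2 * t"
      using t by (simp add: field_simps power2_eq_square mult_le_cancel_left1 mult_le_one)
        (smt (verit) mult_le_cancel_left1)
    then show ?thesis using True by simp
  next
    case False
    obtain l where l: "length v = Suc l" using False by (cases v) auto
    have rt: "t * rho = 1" using t by simp
    have "rho ^ l + t ^ 2 * rho ^ (l + 2) = rho ^ l * (1 + (t * rho) ^ 2)"
      by (simp add: algebra_simps power_add power2_eq_square)
    also have "\<dots> = 2 * (t * rho) * rho ^ l" by (simp add: rt)
    also have "\<dots> = 2 * t * rho ^ Suc l" by simp
    finally show ?thesis
      unfolding sum_letter_mult_length[OF assms False, of "\<lambda>n. rho ^ n"] l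
      using t by simp
  qed
  from mult_left_mono[OF this, of move_prob] show ?thesis
    using move_prob_pos move_prob_q q3 by (simp add: lam_def t_def move_prob_def algebra_simps)
qed

text \<open>
  Differences between a time-dependent probability and its limit satisfy a first-step inequality without source
  terms, so they decay like \<open>lam^m\<close>.  The index \<open>\<sigma>\<close> allows for a state besides \<open>v\<close>, the parity of
  switches, which the lazy step may change.
\<close>

lemma decay:
  fixes d :: "nat \<Rightarrow> 'b \<Rightarrow> nat list \<Rightarrow> real"
  assumes step: "\<And>m \<sigma> v. v \<in> reduced_words q \<Longrightarrow>
      \<exists>\<tau>. d (Suc m) \<sigma> v \<le> p * d m \<tau> v + move_prob * (\<Sum>a<q. d m \<sigma> (letter_mult a v))"
    and init: "\<And>\<sigma> v. v \<in> reduced_words q \<Longrightarrow> d 0 \<sigma> v \<le> C * rho ^ length v"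
    and C: "0 \<le> C" and v: "v \<in> reduced_words q"
  shows "d m \<sigma> v \<le> C * lam ^ m * rho ^ length v"
  using v
proof (induction m arbitrary: \<sigma> v)
  case 0
  then show ?case using init by simp
next
  case (Suc m)
  obtain \<tau> where "d (Suc m) \<sigma> v \<le>
      p * d m \<tau> v + move_prob * (\<Sum>a<q. d m \<sigma> (letter_mult a v))"
    using step[OF Suc.prems] by blast
  also have "\<dots> \<le> p * (C * lam ^ m * rho ^ length v) +
      move_prob * (\<Sum>a<q. C * lam ^ m * rho ^ length (letter_mult a v))"
    using p_pos move_prob_pos Suc
    by (intro add_mono mult_left_mono sum_mono Suc.IH) (auto simp: letter_mult_reduced)
  also have "\<dots> = C * lam ^ m *
      (p * rho ^ length v + move_prob * (\<Sum>a<q. rho ^ length (letter_mult a v)))"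
    by (simp add: sum_distrib_left algebra_simps)
  also have "\<dots> \<le> C * lam ^ m * (lam * rho ^ length v)"
    using C lam_nonneg by (intro mult_left_mono neighbour_sum_rho Suc.prems) auto
  finally show ?case by (simp add: algebra_simps)
qed

lemma F_harmonic:
  assumes "v \<in> reduced_words q" "v \<noteq> []"
  shows "p * F ^ length v + move_prob * (\<Sum>a<q. F ^ length (letter_mult a v)) = F ^ length v"
proof -
  obtain l where l: "length v = Suc l" using assms by (cases v) auto
  have qF: "(real q - 1) * F = 1" using q3 by (simp add: F_def)
  have "F ^ l + (real q - 1) * F ^ (l + 2) = F ^ l * (1 + ((real q - 1) * F) * F)"
    by (simp add: algebra_simps)
  also have "1 + ((real q - 1) * F) * F = real q * F"
    using qF by (simp add: algebra_simps)
  also have "F ^ l * (real q * F) = q * F ^ Suc l" by (simp add: ac_simps)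
  finally have "(\<Sum>a<q. F ^ length (letter_mult a v)) = q * F ^ length v"
    unfolding sum_letter_mult_length[OF assms, of "\<lambda>n. F ^ n"] l
      Suc_eq_plus1[symmetric] add_2_eq_Suc' diff_Suc_1 .
  then have "move_prob * (\<Sum>a<q. F ^ length (letter_mult a v)) = (1 - p) * F ^ length v"
    by (simp only: mult.assoc[symmetric] move_prob_q)
  then show ?thesis by (simp add: algebra_simps)
qed

text \<open>
  Quantitative transience, with the indicator of a return bounded by \<open>rho^|v|\<close>.
\<close>

lemma return_bound:
  assumes "v \<in> reduced_words q"
  shows "expect m (\<lambda>s. of_bool (rel s v = [])) \<le> lam ^ m * rho ^ length v"
proof -
  have "expect m (\<lambda>s. of_bool (rel s v = [])) \<le> expect m (\<lambda>s. rho ^ length (rel s v))"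
    using rho_pos by (intro expect_mono) auto
  also have "\<dots> \<le> 1 * lam ^ m * rho ^ length v"
    by (rule decay[of "\<lambda>m (_::unit) v. expect m (\<lambda>s. rho ^ length (rel s v))"])
      (use assms in auto)
  finally show ?thesis by simp
qed

text \<open>
  The probability of avoiding the target is harmonic away from it and vanishes on it, as does \<open>1 - F^|v|\<close>.
\<close>

lemma avoid_limit:
  assumes "v \<in> reduced_words q"
  shows "\<bar>expect m (\<lambda>s. of_bool (avoid s v)) - (1 - F ^ length v)\<bar> \<le> lam ^ m * rho ^ length v"
proof -
  define D where "D m v = expect m (\<lambda>s. of_bool (avoid s v)) - (1 - F ^ length v)" for m v
  have "\<bar>D m v\<bar> \<le> 1 * lam ^ m * rho ^ length v"
  proof (rule decay[of "\<lambda>m (_::unit) v. \<bar>D m v\<bar>"])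
    fix m :: nat and \<sigma> :: unit and v assume v: "v \<in> reduced_words q"
    have "\<bar>D (Suc m) v\<bar> \<le> p * \<bar>D m v\<bar> + move_prob * (\<Sum>a<q. \<bar>D m (letter_mult a v)\<bar>)"
    proof (cases "v = []")
      case True
      then show ?thesis using p_pos move_prob_pos
        by (auto simp: D_def expect_const intro!: add_nonneg_nonneg mult_nonneg_nonneg sum_nonneg)
    next
      case False
      have "D (Suc m) v = p * D m v + move_prob * (\<Sum>a<q. D m (letter_mult a v))"
        using F_harmonic[OF v False] False move_prob_q
        by (simp add: D_def sum_subtractf sum.distrib algebra_simps)
      also have "\<bar>\<dots>\<bar> \<le> \<bar>p * D m v\<bar> + \<bar>move_prob * (\<Sum>a<q. D m (letter_mult a v))\<bar>"
        by (rule abs_triangle_ineq)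
      also have "\<dots> = p * \<bar>D m v\<bar> + move_prob * \<bar>\<Sum>a<q. D m (letter_mult a v)\<bar>"
        using p_pos move_prob_pos by (simp add: abs_mult)
      also have "\<dots> \<le> p * \<bar>D m v\<bar> + move_prob * (\<Sum>a<q. \<bar>D m (letter_mult a v)\<bar>)"
        using p_pos move_prob_pos by (intro add_left_mono mult_left_mono sum_abs) auto
      finally show ?thesis .
    qed
    then show "\<exists>\<tau>. \<bar>D (Suc m) v\<bar> \<le> p * \<bar>D m v\<bar> + move_prob * (\<Sum>a<q. \<bar>D m (letter_mult a v)\<bar>)"
      by blast
  next
    fix \<sigma> :: unit and v :: "nat list"
    have "F ^ length v \<le> rho ^ length v"
      using F_pos F_le_rho by (intro power_mono) auto
    then show "\<bar>D 0 v\<bar> \<le> 1 * rho ^ length v"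
      using F_pos rho_pos by (auto simp: D_def)
  qed (use assms in auto)
  then show ?thesis by (simp add: D_def)
qed

lemma avoid_lower:
  assumes "v \<in> reduced_words q"
  shows "1 - F ^ length v \<le> expect m (\<lambda>s. of_bool (avoid s v))"
  using assms
proof (induction m arbitrary: v)
  case 0
  then show ?case using F_pos by auto
next
  case (Suc m)
  show ?case
  proof (cases "v = []")
    case True
    then show ?thesis by (simp add: expect_const)
  next
    case False
    have "1 - F ^ length v = p * (1 - F ^ length v) +
        move_prob * (\<Sum>a<q. 1 - F ^ length (letter_mult a v))"
      using F_harmonic[OF Suc.prems False] move_prob_q
      by (simp add: sum_subtractf algebra_simps)
    also have "\<dots> \<le> p * expect m (\<lambda>s. of_bool (avoid s v)) +
        move_prob * (\<Sum>a<q. expect m (\<lambda>s. of_bool (avoid s (letter_mult a v))))"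
      using p_pos move_prob_pos Suc
      by (intro add_mono mult_left_mono sum_mono Suc.IH) (auto simp: letter_mult_reduced)
    finally show ?thesis using False by simp
  qed
qed


section \<open>Final lamp and final branch at a vertex\<close>

text \<open>
  To find the law of the parity of the switches at the target, a factor \<open>c\<close> is attached to odd parity and the
  first-step recursion is solved for \<open>c = 1\<close> and \<open>c = -1\<close>.  The value \<open>sign_lim c\<close> is the limiting mean of that
  factor for a walk started at the target; \<open>sign_lim_fixed\<close> is its first-step equation.
\<close>

definition sign_lim :: "real \<Rightarrow> real" where
  "sign_lim c = (1 - p) * (1 - F) / (1 - c * p - (1 - p) * F)"

definition chi :: "real \<Rightarrow> nat \<Rightarrow> nat option list \<Rightarrow> nat list \<Rightarrow> real" where
  "chi c a s v = (if lit s v then c else 1) * of_bool (ends_at a (rel s v))"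

text \<open>
  Either the target is never hit and the walk ends in the branch where it starts, or it is hit with probability
  \<open>F^|v|\<close>; from then on the \<open>q\<close> branches are equally likely and independent of the lamp.
\<close>

definition chi_lim :: "real \<Rightarrow> nat \<Rightarrow> nat list \<Rightarrow> real" where
  "chi_lim c a v = of_bool (ends_at a v) * (1 - F ^ length v) + F ^ length v * (sign_lim c / q)"

lemma sign_lim_denom: "c \<le> 1 \<Longrightarrow> (1 - p) * (1 - F) \<le> 1 - c * p - (1 - p) * F"
  using p_pos by (simp add: algebra_simps)

lemma escape_pos: "0 < (1 - p) * (1 - F)"
  using p_less F_less by simp

lemma sign_lim_nonneg: "c \<le> 1 \<Longrightarrow> 0 \<le> sign_lim c" and sign_lim_le_1: "c \<le> 1 \<Longrightarrow> sign_lim c \<le> 1"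
  using sign_lim_denom[of c] escape_pos by (auto simp: sign_lim_def divide_le_eq)

lemma sign_lim_1: "sign_lim 1 = 1"
proof -
  have "1 - 1 * p - (1 - p) * F = (1 - p) * (1 - F)" by (simp add: algebra_simps)
  then show ?thesis using p_less F_less unfolding sign_lim_def by simp
qed

lemma sign_lim_fixed: "c \<le> 1 \<Longrightarrow> sign_lim c = c * p * sign_lim c + (1 - p) * ((1 - F) + F * sign_lim c)"
proof -
  assume "c \<le> 1"
  then have "1 - c * p - (1 - p) * F \<noteq> 0" using sign_lim_denom[of c] escape_pos by linarith
  then have "sign_lim c * (1 - c * p - (1 - p) * F) = (1 - p) * (1 - F)"
    by (simp add: sign_lim_def)
  then show ?thesis by (simp add: algebra_simps)
qed

lemma chi_lim_bound: 
  assumes "c \<le> 1"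
  shows "\<bar>of_bool (ends_at a v) - chi_lim c a v\<bar> \<le> F ^ length v"
proof -
  have *: "0 \<le> sign_lim c / q" "sign_lim c / q \<le> 1"
    using sign_lim_nonneg[OF assms] sign_lim_le_1[OF assms] q3 by (auto simp: divide_le_eq)
  have "of_bool (ends_at a v) - chi_lim c a v = F ^ length v * (of_bool (ends_at a v) - sign_lim c / q)"
    by (simp add: chi_lim_def algebra_simps)
  also have "\<bar>\<dots>\<bar> = F ^ length v * \<bar>of_bool (ends_at a v) - sign_lim c / q\<bar>"
    using F_pos by (simp add: abs_mult)
  also have "\<dots> \<le> F ^ length v * 1"
    using F_pos * by (intro mult_left_mono) auto
  finally show ?thesis by simp
qed

lemma chi_lim_fixed:
  assumes "c \<le> 1" "a < q" "v \<in> reduced_words q"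
  shows "chi_lim c a v = p * (if v = [] then c else 1) * chi_lim c a v + move_prob * (\<Sum>b<q. chi_lim c a (letter_mult b v))"
proof (cases "v = []")
  case True
  have "(\<Sum>b<q. chi_lim c a [b]) = (\<Sum>b<q. if a = b then 1 - F else 0) + real q * (F * (sign_lim c / q))"
    unfolding chi_lim_def by (simp add: sum.distrib if_distrib cong: if_cong)
  also have "\<dots> = (1 - F) + F * sign_lim c"
    using assms(2) q3 by simp
  finally have A: "move_prob * (\<Sum>b<q. chi_lim c a [b]) = (1 - p) * ((1 - F) + F * sign_lim c) / q"
    by (simp add: move_prob_def)
  have "sign_lim c / q = (c * p * sign_lim c + (1 - p) * ((1 - F) + F * sign_lim c)) / q"
    by (rule arg_cong[where f = "\<lambda>x. x / q", OF sign_lim_fixed[OF assms(1)]])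
  also have "\<dots> = p * c * (sign_lim c / q) + (1 - p) * ((1 - F) + F * sign_lim c) / q"
    by (simp add: add_divide_distrib ac_simps)
  finally have B: "sign_lim c / q = p * c * (sign_lim c / q) + (1 - p) * ((1 - F) + F * sign_lim c) / q" .
  have C: "chi_lim c a [] = sign_lim c / q" by (simp add: chi_lim_def)
  show ?thesis
    unfolding True letter_mult.simps A C if_P[OF refl] by (rule B)
next
  case False
  have "chi_lim c a (letter_mult b v) = of_bool (ends_at a v) * (1 - F ^ length (letter_mult b v)) +
      F ^ length (letter_mult b v) * (sign_lim c / q)" for b
    using last_letter_mult[OF False, of b] False
    by (cases "letter_mult b v = []") (auto simp: chi_lim_def)
  then have "(\<Sum>b<q. chi_lim c a (letter_mult b v)) = of_bool (ends_at a v) * (real q - (\<Sum>b<q. F ^ length (letter_mult b v))) +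
      (\<Sum>b<q. F ^ length (letter_mult b v)) * (sign_lim c / q)"
    by (simp add: sum.distrib sum_distrib_left sum_distrib_right sum_divide_distrib sum_subtractf)
  moreover have Hv: "chi_lim c a v = of_bool (ends_at a v) * (1 - F ^ length v) + F ^ length v * (sign_lim c / q)"
    by (rule chi_lim_def)
  moreover have "p * (J * (1 - X) + X * k) + m * (J * (Q - S) + S * k) =
      J * (p + m * Q - (p * X + m * S)) + (p * X + m * S) * k" for J X k m Q S :: real
    by (simp add: algebra_simps)
  ultimately have "p * chi_lim c a v + move_prob * (\<Sum>b<q. chi_lim c a (letter_mult b v)) =
      of_bool (ends_at a v) * (p + move_prob * real q -
        (p * F ^ length v + move_prob * (\<Sum>b<q. F ^ length (letter_mult b v)))) +
      (p * F ^ length v + move_prob * (\<Sum>b<q. F ^ length (letter_mult b v))) * (sign_lim c / q)"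
    by metis
  also have "\<dots> = chi_lim c a v"
    unfolding F_harmonic[OF assms(3) False] move_prob_q Hv by simp
  finally show ?thesis using False by simp
qed

lemma chi_limit:
  assumes "\<bar>c\<bar> = 1" "a < q" "v \<in> reduced_words q"
  shows "\<bar>expect m (\<lambda>s. chi c a s v) - chi_lim c a v\<bar> \<le> lam ^ m * rho ^ length v"
proof -
  have c: "c \<le> 1" "c * c = 1" using assms(1) by (auto simp: abs_if split: if_splits)
  define D where "D m v = expect m (\<lambda>s. chi c a s v) - chi_lim c a v" for m v
  have "\<bar>D m v\<bar> \<le> 1 * lam ^ m * rho ^ length v"
  proof (rule decay[of "\<lambda>m (_::unit) v. \<bar>D m v\<bar>"])
    fix m :: nat and \<sigma> :: unit and v assume v: "v \<in> reduced_words q"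
    have "chi c a (None # s) v = (if v = [] then c else 1) * chi c a s v" for s
      using c by (auto simp: chi_def)
    moreover have "chi c a (Some b # s) v = chi c a s (letter_mult b v)" for b s
      by (auto simp: chi_def)
    ultimately have "expect (Suc m) (\<lambda>s. chi c a s v) =
        p * ((if v = [] then c else 1) * expect m (\<lambda>s. chi c a s v)) +
        move_prob * (\<Sum>b<q. expect m (\<lambda>s. chi c a s (letter_mult b v)))"
      by (simp only: expect.simps(2) expect_cmult)
    then have "D (Suc m) v = p * ((if v = [] then c else 1) * D m v) + move_prob * (\<Sum>b<q. D m (letter_mult b v))"
      using chi_lim_fixed[OF c(1) assms(2) v]
      by (simp add: D_def sum_subtractf algebra_simps)
    also have "\<bar>\<dots>\<bar> \<le> \<bar>p * ((if v = [] then c else 1) * D m v)\<bar> + \<bar>move_prob * (\<Sum>b<q. D m (letter_mult b v))\<bar>"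
      by (rule abs_triangle_ineq)
    also have "\<dots> = p * \<bar>D m v\<bar> + move_prob * \<bar>\<Sum>b<q. D m (letter_mult b v)\<bar>"
      using p_pos move_prob_pos assms(1) by (simp add: abs_mult)
    also have "\<dots> \<le> p * \<bar>D m v\<bar> + move_prob * (\<Sum>b<q. \<bar>D m (letter_mult b v)\<bar>)"
      using move_prob_pos by (intro add_left_mono mult_left_mono sum_abs) auto
    finally show "\<exists>\<tau>. \<bar>D (Suc m) v\<bar> \<le> p * \<bar>D m v\<bar> + move_prob * (\<Sum>b<q. \<bar>D m (letter_mult b v)\<bar>)"
      by blast
  next
    fix \<sigma> :: unit and v :: "nat list"
    have "F ^ length v \<le> rho ^ length v"
      using F_pos F_le_rho by (intro power_mono) auto
    then show "\<bar>D 0 v\<bar> \<le> 1 * rho ^ length v"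
      using chi_lim_bound[OF c(1), where a = a and v = v] by (simp add: D_def chi_def)
  qed (use assms in auto)
  then show ?thesis by (simp add: D_def)
qed

text \<open>
  The limiting probability that the lamp at the starting point is lit.
\<close>

definition nu :: real where "nu = (1 - sign_lim (- 1)) / 2"

lemma branch_limit:
  assumes "a < q" "v \<in> reduced_words q"
  shows "\<bar>expect m (\<lambda>s. of_bool (ends_at a (rel s v))) - chi_lim 1 a v\<bar> \<le> lam ^ m"
proof -
  have "\<bar>expect m (\<lambda>s. chi 1 a s v) - chi_lim 1 a v\<bar> \<le> lam ^ m * rho ^ length v"
    using assms by (intro chi_limit) auto
  also have "\<dots> \<le> lam ^ m * 1"
    using lam_nonneg rho_pos rho_less by (intro mult_left_mono power_le_one) auto
  finally show ?thesis by (simp add: chi_def)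
qed

lemma lit_branch_limit:
  assumes "a < q" "v \<in> reduced_words q"
  shows "\<bar>expect m (\<lambda>s. of_bool (lit s v \<and> ends_at a (rel s v))) - F ^ length v * nu / q\<bar> \<le> lam ^ m"
proof -
  have *: "\<bar>expect m (\<lambda>s. chi c a s v) - chi_lim c a v\<bar> \<le> lam ^ m" if "\<bar>c\<bar> = 1" for c
  proof -
    have "lam ^ m * rho ^ length v \<le> lam ^ m * 1"
      using lam_nonneg rho_pos rho_less by (intro mult_left_mono power_le_one) auto
    then show ?thesis using chi_limit[OF that assms, of m] by simp
  qed
  have "of_bool (lit s v \<and> ends_at a (rel s v)) = 1 / 2 * (chi 1 a s v - chi (- 1) a s v)" for s
    by (auto simp: chi_def)
  then have "expect m (\<lambda>s. of_bool (lit s v \<and> ends_at a (rel s v))) =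
      1 / 2 * (expect m (\<lambda>s. chi 1 a s v) - expect m (\<lambda>s. chi (- 1) a s v))"
    by (simp only: expect_cmult expect_diff)
  moreover have "F ^ length v * nu / q = 1 / 2 * (chi_lim 1 a v - chi_lim (- 1) a v)"
    by (simp add: chi_lim_def nu_def sign_lim_1 diff_divide_distrib algebra_simps)
  moreover have "\<bar>expect m (\<lambda>s. chi 1 a s v) - chi_lim 1 a v\<bar> \<le> lam ^ m"
      "\<bar>expect m (\<lambda>s. chi (- 1) a s v) - chi_lim (- 1) a v\<bar> \<le> lam ^ m"
    by (rule *, simp)+
  moreover have "\<bar>x - y\<bar> \<le> l" if "x = 1 / 2 * (x1 - x2)" "y = 1 / 2 * (y1 - y2)"
      "\<bar>x1 - y1\<bar> \<le> l" "\<bar>x2 - y2\<bar> \<le> l" for x y x1 x2 y1 y2 l :: real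
    using that by argo
  ultimately show ?thesis by blast
qed

text \<open>
  A walk that does not end at its starting point ends in exactly one of the \<open>q\<close> branches there.
\<close>

lemma lit_limit: "\<bar>expect m (\<lambda>s. of_bool (lit s [])) - nu\<bar> \<le> (real q + 1) * lam ^ m"
proof -
  have "expect m (\<lambda>s. of_bool (lit s [])) =
     expect m (\<lambda>s. of_bool (lit s [] \<and> rel s [] = []) + (\<Sum>a<q. of_bool (lit s [] \<and> ends_at a (rel s []))))"
  proof (rule expect_cong)
    fix s assume s: "set s \<subseteq> letters q"
    define r where "r = rel s []"
    have "r \<in> reduced_words q" using rel_reduced[OF s, of "[]"] by (simp add: r_def)
    then have "last r < q" if "r \<noteq> []"
      using last_in_set[OF that] unfolding reduced_words_def by blast
    then have "(\<Sum>a<q. of_bool (ends_at a r)) = (of_bool (r \<noteq> []) :: real)"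
      by (cases "r = []") (auto simp: of_bool_def)
    then show "of_bool (lit s []) = of_bool (lit s [] \<and> rel s [] = []) +
        (\<Sum>a<q. of_bool (lit s [] \<and> ends_at a (rel s [])) :: real)"
      unfolding r_def[symmetric] by (cases "lit s []"; cases "r = []") auto
  qed
  also have "\<dots> = expect m (\<lambda>s. of_bool (lit s [] \<and> rel s [] = [])) +
     (\<Sum>a<q. expect m (\<lambda>s. of_bool (lit s [] \<and> ends_at a (rel s []))))"
    by (simp only: expect_add expect_sum)
  finally have eq: "expect m (\<lambda>s. of_bool (lit s [])) - nu = expect m (\<lambda>s. of_bool (lit s [] \<and> rel s [] = [])) +
     (\<Sum>a<q. expect m (\<lambda>s. of_bool (lit s [] \<and> ends_at a (rel s []))) - nu / q)"
    using q3 by (simp add: sum_subtractf)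
  have "expect m (\<lambda>s. of_bool (lit s [] \<and> rel s [] = [])) \<le> expect m (\<lambda>s. of_bool (rel s [] = []))"
    by (intro expect_mono) auto
  also have "\<dots> \<le> lam ^ m" using return_bound[of "[]" m] by simp
  finally have 1: "expect m (\<lambda>s. of_bool (lit s [] \<and> rel s [] = [])) \<le> lam ^ m" .
  have 2: "0 \<le> expect m (\<lambda>s. of_bool (lit s [] \<and> rel s [] = []))"
    using expect_mono[of m "\<lambda>_. 0" "\<lambda>s. of_bool (lit s [] \<and> rel s [] = [])"] by (simp add: expect_const)
  have "\<bar>\<Sum>a<q. expect m (\<lambda>s. of_bool (lit s [] \<and> ends_at a (rel s []))) - nu / q\<bar> \<le> (\<Sum>a<q. lam ^ m)"
    using lit_branch_limit[of _ "[]" m]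
    by (intro order_trans[OF sum_abs] sum_mono) auto
  then show ?thesis
    unfolding eq using 1 2 by (simp add: algebra_simps abs_le_iff)
qed

section \<open>Vertices left with all lamps off\<close>

text \<open>
  The probability of ever reaching a given neighbour without any switch before, i.e. the first-passage generating
  function of the simple random walk at \<open>1 - p\<close>; \<open>F_hat_quad\<close> is its first-step equation, and
  \<open>F_hat_G\<close> is the renewal identity for the Green function \<open>G_hat\<close>.
\<close>

definition F_hat :: real where
  "F_hat = (real q - sqrt ((real q)\<^sup>2 - 4 * (real q - 1) * (1 - p)\<^sup>2)) / (2 * (real q - 1) * (1 - p))"

lemma F_hat_nonneg: "0 \<le> F_hat" and F_hat_le: "F_hat \<le> F"
    and F_hat_quad: "F_hat = move_prob * (1 + (real q - 1) * F_hat\<^sup>2)"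
    and F_hat_G: "G_hat q p * (1 - (1 - p) * F_hat) = 1"
proof -
  define Q where "Q = real q"
  define z where "z = 1 - p"
  define t where "t = sqrt (Q\<^sup>2 - 4 * (Q - 1) * z\<^sup>2)"
  have Q: "Q \<ge> 3" and z: "0 < z" "z < 1"
    using q3 p_pos p_less by (auto simp: Q_def z_def)
  have zz: "z\<^sup>2 \<le> z" using z by (simp add: power2_eq_square)
  \<comment> \<open>This makes the square root real and yields \<open>F_hat \<le> F\<close>.\<close>
  have "(Q - 2 * z)\<^sup>2 \<le> Q\<^sup>2 - 4 * (Q - 1) * z\<^sup>2"
  proof -
    have "Q * z\<^sup>2 \<le> Q * z" using zz Q by (intro mult_left_mono) auto
    then show ?thesis by (simp add: power2_eq_square algebra_simps)
  qed
  then have t_ge: "Q - 2 * z \<le> t" and "0 \<le> Q\<^sup>2 - 4 * (Q - 1) * z\<^sup>2"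
    unfolding t_def by (rule real_le_rsqrt, rule order_trans[OF zero_le_power2])
  from this(2) have t2: "t\<^sup>2 = Q\<^sup>2 - 4 * (Q - 1) * z\<^sup>2"
    unfolding t_def by (rule real_sqrt_pow2)
  have t_le: "t \<le> Q"
  proof -
    have "0 \<le> 4 * (Q - 1) * z\<^sup>2" using Q by simp
    then show ?thesis unfolding t_def using Q by (intro real_le_lsqrt) linarith+
  qed
  have F_hat: "F_hat = (Q - t) / (2 * (Q - 1) * z)"
    unfolding F_hat_def Q_def[symmetric] z_def[symmetric] t_def ..
  have den: "0 < 2 * (Q - 1) * z" using Q z by simp
  show "0 \<le> F_hat" unfolding F_hat using t_le den by simp
  have "F_hat \<le> 2 * z / (2 * (Q - 1) * z)"
    unfolding F_hat using t_ge den by (intro divide_right_mono) auto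
  also have "2 * z / (2 * (Q - 1) * z) = 1 / (Q - 1)"
    using z Q by (simp add: field_simps)
  finally show "F_hat \<le> F" unfolding F_def Q_def[symmetric] .
  have lin: "(2 * (Q - 1) * z) * F_hat = Q - t"
    using iffD1[OF nonzero_eq_divide_eq F_hat] less_imp_neq[OF den, symmetric]
    by (metis mult.commute)
  then have "((2 * (Q - 1) * z) * F_hat - Q)\<^sup>2 = Q\<^sup>2 - 4 * (Q - 1) * z\<^sup>2"
    using t2 by simp
  then have "(4 * (Q - 1) * z) * ((Q - 1) * z * F_hat\<^sup>2 - Q * F_hat + z) = 0"
    by (simp add: power2_eq_square algebra_simps)
  then have "(Q - 1) * z * F_hat\<^sup>2 - Q * F_hat + z = 0" using Q z by simp
  then show "F_hat = move_prob * (1 + (real q - 1) * F_hat\<^sup>2)"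
    unfolding move_prob_def Q_def[symmetric] z_def[symmetric] using Q by (simp add: field_simps)
  have pos: "Q - 2 + t > 0" "2 * (Q - 1) > 0" using t_ge Q z by auto
  have "2 * (Q - 1) * (z * F_hat) = Q - t" using lin by (simp only: ac_simps)
  then have "2 * (Q - 1) * (1 - z * F_hat) = Q - 2 + t"
    unfolding right_diff_distrib[of _ 1] by simp
  moreover have "G * x = 1" if "G = m / n" "m * x = n" "n > 0" for G m n x :: real
    using that by simp
  ultimately show "G_hat q p * (1 - (1 - p) * F_hat) = 1"
    using pos unfolding G_hat_def Q_def[symmetric] z_def[symmetric] t_def[symmetric] by blast
qed

text \<open>
  The probability of clearing the present vertex when the switches still to come must have parity \<open>\<sigma>\<close>.
  For even parity it is \<open>nu2_hat\<close>; for odd parity a loop and a switch, with total weight \<open>G_hat\<close> times \<open>p\<close>,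
  lead back to the even case.
\<close>

definition cleared_lim :: "bool \<Rightarrow> real" where
  "cleared_lim \<sigma> = (if \<sigma> then p * G_hat q p else 1) * nu2_hat q p"

lemma G_hat_pos: "0 < G_hat q p" and G_hat_p: "p * G_hat q p < 1"
proof -
  have "(1 - p) * F_hat < (1 - p) * 1"
    using F_hat_le F_less p_less by (intro mult_strict_left_mono) auto
  then have *: "p < 1 - (1 - p) * F_hat" by simp
  then have G: "G_hat q p = 1 / (1 - (1 - p) * F_hat)"
    using F_hat_G p_pos by (simp add: field_simps)
  show "0 < G_hat q p" "p * G_hat q p < 1"
    unfolding G using * p_pos by (auto simp: divide_less_eq)
qed

lemma cleared_lim_nonneg: "0 \<le> cleared_lim \<sigma>"
proof -
  have "(G_hat q p)\<^sup>2 * p\<^sup>2 = (p * G_hat q p)\<^sup>2" by (simp add: power_mult_distrib)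
  also have "\<dots> < 1" using G_hat_p G_hat_pos p_pos by (simp add: power_less_one_iff abs_mult)
  finally have "0 \<le> nu2_hat q p"
    unfolding nu2_hat_def using G_hat_pos p_less q3 by simp
  then show ?thesis unfolding cleared_lim_def using G_hat_pos p_pos by simp
qed

lemma cleared_lim_fixed: "cleared_lim \<sigma> = p * cleared_lim (\<not> \<sigma>) + (1 - p) * F_hat * cleared_lim \<sigma> + (if \<sigma> then 0 else move_prob * (1 - F))"
proof -
  define G where "G = G_hat q p"
  have G: "G * (1 - (1 - p) * F_hat) = 1" "G > 0" "p * G < 1"
    using F_hat_G G_hat_pos G_hat_p by (auto simp: G_def)
  define N where "N = nu2_hat q p"
  have "(p * G)\<^sup>2 < 1" using G p_pos by (simp add: power_less_one_iff abs_mult)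
  then have "1 - G\<^sup>2 * p\<^sup>2 \<noteq> 0" by (simp add: power_mult_distrib mult.commute)
  moreover have "(1 - p) * (real q - 2) / (real q * (real q - 1)) = move_prob * (1 - F)"
    using q3 by (simp add: move_prob_def F_def field_simps)
  ultimately have N: "N * (1 - G\<^sup>2 * p\<^sup>2) = G * (move_prob * (1 - F))"
    unfolding N_def nu2_hat_def G_def[symmetric] by simp
  show ?thesis
  proof (cases \<sigma>)
    case True
    have "p * N = p * N * (G * (1 - (1 - p) * F_hat))" using G by simp
    then have "p * G * N = p * N + (1 - p) * F_hat * (p * G * N)" by (simp add: algebra_simps)
    then show ?thesis using True by (simp add: cleared_lim_def N_def[symmetric] G_def[symmetric])
  next
    case False
    have "G * (N * (1 - (1 - p) * F_hat)) = N * (G * (1 - (1 - p) * F_hat))" by simp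
    also have "\<dots> = N" using G by simp
    also have "\<dots> = G * (p * (p * G * N) + move_prob * (1 - F))"
      using N by (simp add: power2_eq_square algebra_simps)
    finally have "N * (1 - (1 - p) * F_hat) = p * (p * G * N) + move_prob * (1 - F)"
      using G(2) by simp
    then show ?thesis using False by (simp add: cleared_lim_def N_def[symmetric] G_def[symmetric] algebra_simps)
  qed
qed

lemma F_hat_harmonic:
  assumes "v \<in> reduced_words q" "v \<noteq> []"
  shows "move_prob * (\<Sum>a<q. F_hat ^ length (letter_mult a v)) = F_hat ^ length v"
proof -
  obtain l where l: "length v = Suc l" using assms by (cases v) auto
  have "move_prob * (F_hat ^ l + (real q - 1) * F_hat ^ (l + 2)) = F_hat ^ l * (move_prob * (1 + (real q - 1) * F_hat\<^sup>2))"
    by (simp add: algebra_simps power2_eq_square)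
  also have "\<dots> = F_hat ^ l * F_hat" using F_hat_quad by simp
  finally show ?thesis
    unfolding sum_letter_mult_length[OF assms, of "\<lambda>n. F_hat ^ n"] l by simp
qed

text \<open>
  Seen at distance \<open>|v|\<close>, clearing the target requires to reach it first without a switch, so the fixed point
  of the first-step recursion is \<open>F_hat^|v|\<close> times its value at the target.  The final exit contributes the
  source term \<open>move_prob\<close> times the probability not to come back, which in finite time is at
  least its limit \<open>1 - F\<close>; this gives the estimate from below.
\<close>

lemma cleared_limit:
  assumes "a < q"
  shows "nu2_hat q p - (cleared_lim False + cleared_lim True) * lam ^ m \<le> expect m (\<lambda>s. of_bool (cleared a s [] False))"
proof -
  define g where "g m v \<sigma> = expect m (\<lambda>s. of_bool (cleared a s v \<sigma>))" for m v \<sigma>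
  \<comment> \<open>Since switches away from the target are lost, the recursion is only substochastic; the positive part of the deficit still satisfies the inequality that the contraction needs.\<close>
  define d where "d m \<sigma> v = max 0 (F_hat ^ length v * cleared_lim \<sigma> - g m v \<sigma>)" for m \<sigma> v
  have "d m False [] \<le> (cleared_lim False + cleared_lim True) * lam ^ m * rho ^ length ([] :: nat list)"
  proof (rule decay[of d])
    fix m \<sigma> v assume v: "v \<in> reduced_words q"
    have None: "of_bool (cleared a (None # s) v \<sigma>) = of_bool (v = []) * (of_bool (cleared a s [] (\<not> \<sigma>)) :: real)" for s
      by simp
    have Some: "of_bool (cleared a (Some b # s) v \<sigma>) = (of_bool (cleared a s (letter_mult b v) \<sigma>) :: real) +
        of_bool (v = [] \<and> b = a \<and> \<not> \<sigma>) * of_bool (avoid s [a])" for b s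
      using cleared_imp_visit[of a s "letter_mult b v" \<sigma>] by auto
    have g_Suc: "g (Suc m) v \<sigma> = p * (of_bool (v = []) * g m [] (\<not> \<sigma>)) +
        move_prob * (\<Sum>b<q. g m (letter_mult b v) \<sigma> +
          of_bool (v = [] \<and> b = a \<and> \<not> \<sigma>) * expect m (\<lambda>s. of_bool (avoid s [a])))"
      unfolding g_def expect.simps(2) None Some expect_add expect_cmult ..
    have d_ge: "F_hat ^ length v * cleared_lim \<sigma> - g m v \<sigma> \<le> d m \<sigma> v" "0 \<le> d m \<sigma> v" for m \<sigma> v
      by (auto simp: d_def)
    have d_ge': "(\<Sum>b<q. F_hat ^ length (letter_mult b v) * cleared_lim \<sigma> - g m (letter_mult b v) \<sigma>)
        \<le> (\<Sum>b<q. d m \<sigma> (letter_mult b v))"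
      by (intro sum_mono d_ge)
    have "F_hat ^ length v * cleared_lim \<sigma> - g (Suc m) v \<sigma> \<le>
        p * d m (\<not> \<sigma>) v + move_prob * (\<Sum>b<q. d m \<sigma> (letter_mult b v))"
    proof (cases "v = []")
      case True
      have "(\<Sum>b<q. of_bool (b = a \<and> \<not> \<sigma>) * expect m (\<lambda>s. of_bool (avoid s [a]))) =
          (if \<sigma> then 0 else expect m (\<lambda>s. of_bool (avoid s [a])))"
        using assms by (simp add: of_bool_def if_distrib[of "\<lambda>x. x * _"] cong: if_cong)
      moreover have "(if \<sigma> then 0 else 1 - F) \<le> (if \<sigma> then 0 else expect m (\<lambda>s. of_bool (avoid s [a])))"
        using avoid_lower[of "[a]" m] assms by simp
      ultimately have "move_prob * (if \<sigma> then 0 else 1 - F) \<le>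
          move_prob * (\<Sum>b<q. of_bool (b = a \<and> \<not> \<sigma>) * expect m (\<lambda>s. of_bool (avoid s [a])))"
        using move_prob_pos by (intro mult_left_mono) auto
      then have "p * g m [] (\<not> \<sigma>) + move_prob * (\<Sum>b<q. g m [b] \<sigma>) + move_prob * (if \<sigma> then 0 else 1 - F)
          \<le> g (Suc m) v \<sigma>"
        unfolding g_Suc using True by (simp add: sum.distrib distrib_left)
      moreover have "cleared_lim \<sigma> = p * cleared_lim (\<not> \<sigma>) + move_prob * (\<Sum>b<q. F_hat * cleared_lim \<sigma>) + move_prob * (if \<sigma> then 0 else 1 - F)"
      proof -
        have "(1 - p) * F_hat * cleared_lim \<sigma> = move_prob * (\<Sum>b<q. F_hat * cleared_lim \<sigma>)"
          unfolding move_prob_q[symmetric] by simp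
        moreover have "(if \<sigma> then 0 else move_prob * (1 - F)) = move_prob * (if \<sigma> then 0 else 1 - F)"
          by simp
        ultimately show ?thesis using cleared_lim_fixed[of \<sigma>] by argo
      qed
      ultimately have "cleared_lim \<sigma> - g (Suc m) v \<sigma> \<le>
          p * (cleared_lim (\<not> \<sigma>) - g m [] (\<not> \<sigma>)) + move_prob * (\<Sum>b<q. F_hat * cleared_lim \<sigma> - g m [b] \<sigma>)"
        by (simp add: sum_subtractf right_diff_distrib)
      also have "\<dots> \<le> p * d m (\<not> \<sigma>) [] + move_prob * (\<Sum>b<q. d m \<sigma> [b])"
        using d_ge(1)[of "[]" "\<not> \<sigma>" m] d_ge' p_pos move_prob_pos True
        by (intro add_mono mult_left_mono) auto
      finally show ?thesis using True by simp
    next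
      case False
      have "F_hat ^ length v * cleared_lim \<sigma> - g (Suc m) v \<sigma> =
          move_prob * (\<Sum>b<q. F_hat ^ length (letter_mult b v) * cleared_lim \<sigma> - g m (letter_mult b v) \<sigma>)"
        unfolding g_Suc F_hat_harmonic[OF v False, symmetric] using False
        by (simp add: sum_subtractf sum_distrib_left sum_distrib_right right_diff_distrib mult.assoc)
      also have "\<dots> \<le> 0 + move_prob * (\<Sum>b<q. d m \<sigma> (letter_mult b v))"
        using d_ge' move_prob_pos by simp
      also have "\<dots> \<le> p * d m (\<not> \<sigma>) v + move_prob * (\<Sum>b<q. d m \<sigma> (letter_mult b v))"
        using d_ge(2)[of m "\<not> \<sigma>" v] p_pos by (intro add_right_mono) auto
      finally show ?thesis .
    qed
    moreover have "0 \<le> p * d m (\<not> \<sigma>) v + move_prob * (\<Sum>b<q. d m \<sigma> (letter_mult b v))"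
      using p_pos move_prob_pos d_ge(2) by (intro add_nonneg_nonneg mult_nonneg_nonneg sum_nonneg) auto
    ultimately show "\<exists>\<tau>. d (Suc m) \<sigma> v \<le> p * d m \<tau> v + move_prob * (\<Sum>b<q. d m \<sigma> (letter_mult b v))"
      by (intro exI[of _ "\<not> \<sigma>"]) (simp add: d_def)
  next
    fix \<sigma> :: bool and v :: "nat list"
    have "F_hat ^ length v \<le> rho ^ length v"
      using F_hat_nonneg F_hat_le F_le_rho by (intro power_mono) auto
    moreover have "cleared_lim \<sigma> \<le> cleared_lim False + cleared_lim True"
      using cleared_lim_nonneg[of True] cleared_lim_nonneg[of False] by (cases \<sigma>) auto
    ultimately have "F_hat ^ length v * cleared_lim \<sigma> \<le> rho ^ length v * (cleared_lim False + cleared_lim True)"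
      using cleared_lim_nonneg[of \<sigma>] rho_pos by (intro mult_mono) auto
    then show "d 0 \<sigma> v \<le> (cleared_lim False + cleared_lim True) * rho ^ length v"
      using cleared_lim_nonneg rho_pos by (simp add: d_def g_def mult.commute)
  qed (use cleared_lim_nonneg in auto)
  then have "cleared_lim False - g m [] False \<le> (cleared_lim False + cleared_lim True) * lam ^ m"
    by (simp add: d_def)
  then show ?thesis by (simp add: g_def cleared_lim_def)
qed

end


section \<open>Expected sizes after finitely many steps\<close>

lemma inj_on_letter_mult: "inj_on (letter_mult a) (reduced_words q)"
  by (rule inj_on_inverseI[where g = "letter_mult a"])
    (auto simp: letter_mult_twice reduced_words_def)

context lamplighter_walk
begin

definition lit_set :: "nat option list \<Rightarrow> nat list set" where
  "lit_set s = {y \<in> reduced_words q. lit s y}"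

definition lit_on_path :: "nat option list \<Rightarrow> nat list set" where
  "lit_on_path s = {y \<in> lit_set s. prefix y (pos s)}"

text \<open>
  The vertices off the geodesic that every tour through the lit lamps has to visit.
\<close>

definition off_path :: "nat option list \<Rightarrow> nat list set" where
  "off_path s = {y \<in> reduced_words q. \<not> prefix y (pos s) \<and> (\<exists>z \<in> lit_set s. prefix y z)}"

lemma lit_set_None: "lit_set (None # s) = (if lit s [] then lit_set s - {[]} else insert [] (lit_set s))"
proof (rule Set.set_eqI)
  fix y show "y \<in> lit_set (None # s) \<longleftrightarrow> y \<in> (if lit s [] then lit_set s - {[]} else insert [] (lit_set s))"
    by (cases "y = []"; cases "lit s []") (simp_all add: lit_set_def)
qed

lemma lit_set_Some: "a < q \<Longrightarrow> lit_set (Some a # s) = letter_mult a ` lit_set s"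
proof (intro Set.set_eqI iffI)
  fix y assume a: "a < q" and y: "y \<in> lit_set (Some a # s)"
  then have "letter_mult a y \<in> lit_set s"
    by (simp add: lit_set_def letter_mult_reduced)
  moreover have "y = letter_mult a (letter_mult a y)"
    using y step_step[of y q "Some a"] by (simp add: lit_set_def)
  ultimately show "y \<in> letter_mult a ` lit_set s" by blast
next
  fix y assume a: "a < q" and "y \<in> letter_mult a ` lit_set s"
  then obtain z where "z \<in> lit_set s" "y = letter_mult a z" by blast
  then show "y \<in> lit_set (Some a # s)"
    using a step_step[of z q "Some a"] by (simp add: lit_set_def letter_mult_reduced)
qed

lemma finite_lit_set: "set s \<subseteq> letters q \<Longrightarrow> finite (lit_set s)"
proof (induction s)
  case (Cons x s)
  then show ?case
    by (cases x) (auto simp: lit_set_None lit_set_Some letters_def)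
qed (simp add: lit_set_def)

lemma finite_lit_on_path: "set s \<subseteq> letters q \<Longrightarrow> finite (lit_on_path s)"
  using finite_lit_set by (simp add: lit_on_path_def)

lemma Nil_in_lit_set: "[] \<in> lit_set s \<longleftrightarrow> lit s []" and Nil_in_lit_on_path: "[] \<in> lit_on_path s \<longleftrightarrow> lit s []"
  by (auto simp: lit_set_def lit_on_path_def)

lemma card_toggle:
  assumes "finite A"
  shows "real (card (if b \<in> A then A - {b} else insert b A)) = real (card A) + (1 - 2 * of_bool (b \<in> A))"
proof (cases "b \<in> A")
  case True
  then have "card A = Suc (card (A - {b}))" using card.remove[OF assms True] by blast
  then show ?thesis using True by simp
next
  case False
  then show ?thesis using assms by simp
qed

lemma card_lit_set_None:
  "set s \<subseteq> letters q \<Longrightarrow> real (card (lit_set (None # s))) = real (card (lit_set s)) + (1 - 2 * of_bool (lit s []))"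
  using card_toggle[of "lit_set s" "[]"] finite_lit_set[of s] by (simp add: lit_set_None Nil_in_lit_set)

lemma card_lit_on_path_None:
  assumes "set s \<subseteq> letters q"
  shows "real (card (lit_on_path (None # s))) = real (card (lit_on_path s)) + (1 - 2 * of_bool (lit s []))"
proof -
  have "lit_on_path (None # s) = (if lit s [] then lit_on_path s - {[]} else insert [] (lit_on_path s))"
    by (auto simp: lit_on_path_def lit_set_None)
  then show ?thesis
    using card_toggle[of "lit_on_path s" "[]"] finite_lit_on_path[OF assms] by (simp add: Nil_in_lit_on_path)
qed

lemma card_lit_set_Some: "a < q \<Longrightarrow> card (lit_set (Some a # s)) = card (lit_set s)"
  unfolding lit_set_Some
  by (rule card_image) (rule inj_on_subset[OF inj_on_letter_mult], auto simp: lit_set_def)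

text \<open>
  Putting the move \<open>a\<close> in front replaces the geodesic from \<open>o\<close> to \<open>x\<close> by the one from \<open>a\<close> to \<open>x\<close>: it loses \<open>o\<close>
  if \<open>x\<close> lies in the branch of \<open>a\<close>, and gains \<open>a\<close> otherwise.
\<close>

lemma card_lit_on_path_Some:
  assumes s: "set s \<subseteq> letters q" and a: "a < q"
  shows "real (card (lit_on_path (Some a # s))) \<le> real (card (lit_on_path s)) +
    of_bool (lit s [a] \<and> ends_at a (rel s [a])) - of_bool (lit s [] \<and> ends_at a (rel s []))"
proof -
  have x: "pos s \<in> reduced_words q" by (rule pos_reduced[OF s])
  have inj: "inj_on (letter_mult a) (lit_on_path (Some a # s))"
    by (rule inj_on_subset[OF inj_on_letter_mult[of a q]]) (auto simp: lit_on_path_def lit_set_def)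
  have lit: "letter_mult a y \<in> lit_set s" if "y \<in> lit_on_path (Some a # s)" for y
    using that a by (auto simp: lit_on_path_def lit_set_def letter_mult_reduced)
  have pre: "prefix y (letter_mult a (pos s))" if "y \<in> lit_on_path (Some a # s)" for y
    using that by (auto simp: lit_on_path_def)
  show ?thesis
  proof (cases "prefix [a] (pos s)")
    case True
    then obtain w where w: "pos s = a # w" by (auto simp: prefix_def)
    have "letter_mult a ` lit_on_path (Some a # s) \<subseteq> lit_on_path s - {[]}"
    proof
      fix z assume "z \<in> letter_mult a ` lit_on_path (Some a # s)"
      then obtain y where y: "y \<in> lit_on_path (Some a # s)" "z = letter_mult a y" by blast
      then have "prefix y w" using pre[OF y(1)] w by simp
      then have "z = a # y"
        using w x y(2) by (cases y; cases w) (auto simp: reduced_words_def)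
      then show "z \<in> lit_on_path s - {[]}"
        using lit[OF y(1)] \<open>prefix y w\<close> y(2) w by (auto simp: lit_on_path_def)
    qed
    from card_inj_on_le[OF inj this] have "real (card (lit_on_path (Some a # s))) \<le> real (card (lit_on_path s - {[]}))"
      using finite_lit_on_path[OF s] by simp
    moreover have "real (card (lit_on_path s - {[]})) = real (card (lit_on_path s)) - of_bool (lit s [])"
      using card_toggle[OF finite_lit_on_path[OF s], of "[]"] Nil_in_lit_on_path[of s]
      by (cases "lit s []") auto
    moreover have "of_bool (lit s [] \<and> ends_at a (rel s [])) = (of_bool (lit s []) :: real)"
      using rel_Nil_conv[OF s] w by simp
    moreover have "0 \<le> (of_bool (lit s [a] \<and> ends_at a (rel s [a])) :: real)"
      by simp
    ultimately show ?thesis by linarith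
  next
    case False
    have pa: "letter_mult a (pos s) = a # pos s" using False by (cases "pos s") auto
    have "letter_mult a ` lit_on_path (Some a # s) \<subseteq> lit_on_path s \<union> (if lit s [a] then {[a]} else {})"
    proof
      fix z assume "z \<in> letter_mult a ` lit_on_path (Some a # s)"
      then obtain y where y: "y \<in> lit_on_path (Some a # s)" "z = letter_mult a y" by blast
      show "z \<in> lit_on_path s \<union> (if lit s [a] then {[a]} else {})"
        using pre[OF y(1)] lit[OF y(1)] y(2) by (cases y) (auto simp: lit_on_path_def lit_set_def pa)
    qed
    from card_inj_on_le[OF inj this] have "card (lit_on_path (Some a # s)) \<le>
        card (lit_on_path s \<union> (if lit s [a] then {[a]} else {}))"
      using finite_lit_on_path[OF s] by simp
    also have "\<dots> \<le> card (lit_on_path s) + (if lit s [a] then 1 else 0)"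
      using card_Un_le[of "lit_on_path s" "if lit s [a] then {[a]} else {}"] by (simp split: if_splits)
    finally have "real (card (lit_on_path (Some a # s))) \<le> real (card (lit_on_path s)) + of_bool (lit s [a])"
      by (simp split: if_splits)
    moreover have "ends_at a (rel s [a])"
      using not_prefix_ends_at[OF False] rel_conv_pos[OF s, of "[a]"] x a
      by (auto simp: reduced_words_def)
    moreover have "\<not> ends_at a (rel s [])"
      using rel_Nil_conv[OF s] False by (cases "pos s") auto
    ultimately show ?thesis
      by (simp only: simp_thms not_False_eq_True of_bool_eq diff_zero)
  qed
qed

lemma expect_first_step:
  "expect (Suc n) f = expect n (\<lambda>s. p * f (None # s) + move_prob * (\<Sum>a<q. f (Some a # s)))"
  by (simp add: expect_add expect_cmult expect_sum)

text \<open>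
  The distance grows by \<open>(q - 2)/q\<close> per move on average, except at the root where it must grow.
\<close>

lemma distance_drift:
  "expect (Suc n) (\<lambda>s. real (length (pos s))) =
   expect n (\<lambda>s. real (length (pos s))) + move_prob * (real q - 2) + 2 * move_prob * expect n (\<lambda>s. of_bool (rel s [] = []))"
proof -
  have "expect (Suc n) (\<lambda>s. real (length (pos s))) =
     expect n (\<lambda>s. real (length (pos s)) + (move_prob * (real q - 2) + 2 * move_prob * of_bool (rel s [] = [])))"
    unfolding expect_first_step
  proof (rule expect_cong)
    fix s assume s: "set s \<subseteq> letters q"
    define l where "l = real (length (pos s))"
    have "(\<Sum>a<q. real (length (letter_mult a (pos s)))) =
        real q * l + (real q - 2) + 2 * of_bool (pos s = [])"
    proof (cases "pos s = []")
      case False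
      then have "real (length (pos s) - 1) = l - 1" by (cases "pos s") (auto simp: l_def)
      then show ?thesis
        using False sum_letter_mult_length[OF pos_reduced[OF s] False, of real]
        by (simp add: l_def algebra_simps)
    qed (simp add: l_def)
    moreover have "p * l + move_prob * (real q * l + (real q - 2) + 2 * b) =
        l + (move_prob * (real q - 2) + 2 * move_prob * b)" for b
    proof -
      have "p * l + move_prob * (real q * l + (real q - 2) + 2 * b) =
          p * l + (move_prob * real q) * l + (move_prob * (real q - 2) + 2 * move_prob * b)"
        by (simp add: algebra_simps)
      then show ?thesis unfolding move_prob_q by (simp add: algebra_simps)
    qed
    moreover have "rel s [] = [] \<longleftrightarrow> pos s = []" using rel_Nil_conv[OF s] by simp
    ultimately show "p * real (length (pos (None # s))) + move_prob * (\<Sum>a<q. real (length (pos (Some a # s)))) =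
        real (length (pos s)) + (move_prob * (real q - 2) + 2 * move_prob * of_bool (rel s [] = []))"
      by (simp add: l_def)
  qed
  then show ?thesis by (simp only: expect_add expect_cmult expect_const add.assoc)
qed

lemma distance_lower: "real n * (move_prob * (real q - 2)) \<le> expect n (\<lambda>s. real (length (pos s)))"
proof (induction n)
  case (Suc n)
  have "0 \<le> expect n (\<lambda>s. of_bool (rel s [] = []))"
    using expect_mono[of n "\<lambda>_. 0" "\<lambda>s. of_bool (rel s [] = [])"] by (simp add: expect_const)
  then have "0 \<le> 2 * move_prob * expect n (\<lambda>s. of_bool (rel s [] = []))" using move_prob_pos by simp
  then show ?case using Suc unfolding distance_drift by (simp add: algebra_simps)
qed simp

lemma distance_upper:
  "expect n (\<lambda>s. real (length (pos s))) \<le> real n * (move_prob * (real q - 2)) + 2 * move_prob / (1 - lam)"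
proof -
  have "expect n (\<lambda>s. real (length (pos s))) \<le>
      expect 0 (\<lambda>s. real (length (pos s))) + real n * (move_prob * (real q - 2)) + 2 * move_prob / (1 - lam)"
  proof (rule drift_bound)
    fix n
    have "2 * move_prob * expect n (\<lambda>s. of_bool (rel s [] = [])) \<le> 2 * move_prob * lam ^ n"
      using return_bound[of "[]" n] move_prob_pos by (intro mult_left_mono) auto
    then show "expect (Suc n) (\<lambda>s. real (length (pos s))) \<le>
        expect n (\<lambda>s. real (length (pos s))) + move_prob * (real q - 2) + 2 * move_prob * lam ^ n"
      unfolding distance_drift by simp
  qed (use lam_nonneg lam_less move_prob_pos in auto)
  then show ?thesis by simp
qed

text \<open>
  Moves put in front only translate the lit set; a switch put in front toggles the lamp at the root.
\<close>

lemma lit_drift: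
  "expect (Suc n) (\<lambda>s. real (card (lit_set s))) =
   expect n (\<lambda>s. real (card (lit_set s))) + p * (1 - 2 * expect n (\<lambda>s. of_bool (lit s [])))"
proof -
  have "expect (Suc n) (\<lambda>s. real (card (lit_set s))) =
     expect n (\<lambda>s. real (card (lit_set s)) + p * (1 - 2 * of_bool (lit s [])))"
    unfolding expect_first_step
  proof (rule expect_cong)
    fix s assume s: "set s \<subseteq> letters q"
    have "move_prob * (real q * x) = (1 - p) * x" for x
      by (simp only: mult.assoc[symmetric] move_prob_q)
    then have "p * (x + y) + move_prob * (real q * x) = x + p * y" for x y
      by (simp only:) (simp add: algebra_simps)
    then show "p * real (card (lit_set (None # s))) + move_prob * (\<Sum>a<q. real (card (lit_set (Some a # s)))) =
        real (card (lit_set s)) + p * (1 - 2 * of_bool (lit s []))"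
      by (simp add: card_lit_set_None[OF s] card_lit_set_Some)
  qed
  then show ?thesis by (simp only: expect_add expect_cmult expect_const expect_diff)
qed

lemma lit_prob_lower: "p * (1 - 2 * nu) - 2 * (real q + 1) * lam ^ n \<le>
      p * (1 - 2 * expect n (\<lambda>s. of_bool (lit s [])))"
  and lit_prob_upper: "p * (1 - 2 * expect n (\<lambda>s. of_bool (lit s []))) \<le>
      p * (1 - 2 * nu) + 2 * (real q + 1) * lam ^ n"
proof -
  have "\<bar>p * (1 - 2 * x) - p * (1 - 2 * y)\<bar> = 2 * (p * \<bar>x - y\<bar>)" for x y
  proof -
    have "p * (1 - 2 * x) - p * (1 - 2 * y) = - (2 * p) * (x - y)" by (simp add: algebra_simps)
    then show ?thesis using p_pos by (simp add: abs_mult)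
  qed
  moreover have "2 * (p * \<bar>x\<bar>) \<le> 2 * (1 * \<bar>x\<bar>)" for x :: real
    using p_less by (intro mult_left_mono mult_right_mono) auto
  ultimately have "\<bar>p * (1 - 2 * x) - p * (1 - 2 * y)\<bar> \<le> 2 * \<bar>x - y\<bar>" for x y
    by simp
  from order_trans[OF this mult_left_mono[OF lit_limit]]
  have "\<bar>p * (1 - 2 * expect n (\<lambda>s. of_bool (lit s []))) - p * (1 - 2 * nu)\<bar> \<le>
      2 * ((real q + 1) * lam ^ n)" by simp
  then show "p * (1 - 2 * nu) - 2 * (real q + 1) * lam ^ n \<le>
      p * (1 - 2 * expect n (\<lambda>s. of_bool (lit s [])))"
    "p * (1 - 2 * expect n (\<lambda>s. of_bool (lit s []))) \<le>
      p * (1 - 2 * nu) + 2 * (real q + 1) * lam ^ n"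
    unfolding abs_diff_le_iff mult.assoc[symmetric] by blast+
qed

lemma lit_upper:
  "expect n (\<lambda>s. real (card (lit_set s))) \<le> real n * (p * (1 - 2 * nu)) + 2 * (real q + 1) / (1 - lam)"
proof -
  have "expect n (\<lambda>s. real (card (lit_set s))) \<le> expect 0 (\<lambda>s. real (card (lit_set s))) +
      real n * (p * (1 - 2 * nu)) + 2 * (real q + 1) / (1 - lam)"
  proof (rule drift_bound)
    show "expect (Suc n) (\<lambda>s. real (card (lit_set s))) \<le> expect n (\<lambda>s. real (card (lit_set s))) +
        p * (1 - 2 * nu) + 2 * (real q + 1) * lam ^ n" for n
      unfolding lit_drift add.assoc by (rule add_left_mono[OF lit_prob_upper])
  qed (use lam_nonneg lam_less in auto)
  then show ?thesis by (simp add: lit_set_def)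
qed

lemma lit_lower:
  "real n * (p * (1 - 2 * nu)) - 2 * (real q + 1) / (1 - lam) \<le> expect n (\<lambda>s. real (card (lit_set s)))"
proof -
  have "- expect n (\<lambda>s. real (card (lit_set s))) \<le> - expect 0 (\<lambda>s. real (card (lit_set s))) +
      real n * - (p * (1 - 2 * nu)) + 2 * (real q + 1) / (1 - lam)"
  proof (rule drift_bound[of "\<lambda>n. - expect n (\<lambda>s. real (card (lit_set s)))"])
    show "- expect (Suc n) (\<lambda>s. real (card (lit_set s))) \<le> - expect n (\<lambda>s. real (card (lit_set s))) +
        - (p * (1 - 2 * nu)) + 2 * (real q + 1) * lam ^ n" for n
    proof -
      have "- (x + z) \<le> - x + - y + b" if "y - b \<le> z" for x y z b :: real
        using that by simp
      from this[OF lit_prob_lower] show ?thesis unfolding lit_drift .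
    qed
  qed (use lam_nonneg lam_less in auto)
  then show ?thesis by (simp add: lit_set_def)
qed

text \<open>
  By \<open>card_lit_on_path_Some\<close> a move gains the lamp at \<open>a\<close> and loses that at the root, each restricted to the
  event that the final branch is the right one.  The gain carries an extra factor \<open>F\<close>, because \<open>a\<close> must be hit
  before its lamp can be lit.
\<close>

lemma on_path_drift:
  "expect (Suc n) (\<lambda>s. real (card (lit_on_path s))) \<le>
   expect n (\<lambda>s. real (card (lit_on_path s))) + (p * (1 - 2 * nu) - (1 - p) * (1 - F) * nu / q) +
   (2 * (real q + 1) + 2) * lam ^ n"
proof -
  define P1 where "P1 a s = (of_bool (lit s [a] \<and> ends_at a (rel s [a])) :: real)" for a s
  define P0 where "P0 a s = (of_bool (lit s [] \<and> ends_at a (rel s [])) :: real)" for a s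
  have "expect (Suc n) (\<lambda>s. real (card (lit_on_path s))) \<le>
     expect n (\<lambda>s. real (card (lit_on_path s)) + (p * (1 - 2 * of_bool (lit s [])) + move_prob * (\<Sum>a<q. P1 a s - P0 a s)))"
    unfolding expect_first_step
  proof (rule expect_mono)
    fix s assume s: "set s \<subseteq> letters q"
    define x where "x = real (card (lit_on_path s))"
    have "(\<Sum>a<q. real (card (lit_on_path (Some a # s)))) \<le> (\<Sum>a<q. x + (P1 a s - P0 a s))"
      using card_lit_on_path_Some[OF s] by (intro sum_mono) (auto simp: P1_def P0_def x_def add_diff_eq)
    then have "move_prob * (\<Sum>a<q. real (card (lit_on_path (Some a # s)))) \<le> move_prob * (\<Sum>a<q. x + (P1 a s - P0 a s))"
      using move_prob_pos by (intro mult_left_mono) auto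
    also have "\<dots> = (1 - p) * x + move_prob * (\<Sum>a<q. P1 a s - P0 a s)"
    proof -
      have "(\<Sum>a<q. x + (P1 a s - P0 a s)) = real q * x + (\<Sum>a<q. P1 a s - P0 a s)"
        by (simp only: sum.distrib sum_constant card_lessThan)
      then show ?thesis unfolding move_prob_q[symmetric] by (simp only: distrib_left mult.assoc)
    qed
    finally show "p * real (card (lit_on_path (None # s))) + move_prob * (\<Sum>a<q. real (card (lit_on_path (Some a # s)))) \<le>
        real (card (lit_on_path s)) + (p * (1 - 2 * of_bool (lit s [])) + move_prob * (\<Sum>a<q. P1 a s - P0 a s))"
      unfolding card_lit_on_path_None[OF s] x_def[symmetric] by (simp add: algebra_simps)
  qed
  also have "\<dots> = expect n (\<lambda>s. real (card (lit_on_path s))) + (p * (1 - 2 * expect n (\<lambda>s. of_bool (lit s []))) +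
      move_prob * (\<Sum>a<q. expect n (P1 a) - expect n (P0 a)))"
    by (simp only: expect_add expect_cmult expect_const expect_diff expect_sum)
  also have "\<dots> \<le> expect n (\<lambda>s. real (card (lit_on_path s))) + (p * (1 - 2 * nu) + 2 * (real q + 1) * lam ^ n +
      move_prob * (\<Sum>a<q. (F * nu / q + lam ^ n) - (nu / q - lam ^ n)))"
  proof (intro add_left_mono add_mono mult_left_mono sum_mono diff_mono)
    show "p * (1 - 2 * expect n (\<lambda>s. of_bool (lit s []))) \<le> p * (1 - 2 * nu) + 2 * (real q + 1) * lam ^ n"
      by (rule lit_prob_upper)
    show "expect n (P1 a) \<le> F * nu / q + lam ^ n" if "a \<in> {..<q}" for a
      using lit_branch_limit[of a "[a]" n] that unfolding P1_def by (simp add: abs_le_iff)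
    show "nu / q - lam ^ n \<le> expect n (P0 a)" if "a \<in> {..<q}" for a
      using lit_branch_limit[of a "[]" n] that unfolding P0_def by (simp add: abs_le_iff)
  qed (use move_prob_pos in auto)
  also have "move_prob * (\<Sum>a<q. (F * nu / q + lam ^ n) - (nu / q - lam ^ n)) =
      - ((1 - p) * (1 - F) * nu / q) + (1 - p) * (2 * lam ^ n)"
    unfolding move_prob_q[symmetric] using q3 by (simp add: field_simps)
  also have "(1 - p) * (2 * lam ^ n) \<le> 1 * (2 * lam ^ n)"
    using p_pos lam_nonneg by (intro mult_right_mono) auto
  finally show ?thesis by (simp add: algebra_simps)
qed

lemma on_path_upper:
  "expect n (\<lambda>s. real (card (lit_on_path s))) \<le>
   real n * (p * (1 - 2 * nu) - (1 - p) * (1 - F) * nu / q) + (2 * (real q + 1) + 2) / (1 - lam)"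
proof -
  have "expect n (\<lambda>s. real (card (lit_on_path s))) \<le> expect 0 (\<lambda>s. real (card (lit_on_path s))) +
      real n * (p * (1 - 2 * nu) - (1 - p) * (1 - F) * nu / q) + (2 * (real q + 1) + 2) / (1 - lam)"
    by (rule drift_bound) (use on_path_drift lam_nonneg lam_less in auto)
  then show ?thesis by (simp add: lit_on_path_def lit_set_def)
qed

text \<open>
  The walk after \<open>s\<close> makes a step \<open>x\<close> to a new vertex, and its continuation \<open>t\<close> returns to the side it came
  from without clearing that vertex.
\<close>

definition new_branch :: "nat option list \<Rightarrow> nat option \<Rightarrow> nat option list \<Rightarrow> bool" where
  "new_branch s x t \<longleftrightarrow> (\<exists>a<q. x = Some a \<and> avoid (rev s) [a] \<and>
     ends_at a (rel t []) \<and> \<not> cleared a t [] False)"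

lemma card_off_path_le:
  assumes s: "set s \<subseteq> letters q"
  shows "card (off_path s) \<le> (\<Sum>k<length s. of_bool (new_branch (take k s) (s ! k) (drop (Suc k) s)))"
proof -
  let ?K = "{k \<in> {..<length s}. new_branch (take k s) (s ! k) (drop (Suc k) s)}"
  have "off_path s \<subseteq> (\<lambda>k. pos (take (Suc k) s)) ` ?K"
  proof
    fix y assume "y \<in> off_path s"
    then obtain z where "y \<in> reduced_words q" "\<not> prefix y (pos s)"
        "z \<in> reduced_words q" "lit s z" "prefix y z"
      by (auto simp: off_path_def lit_set_def)
    from lit_branch_first_visit[OF s this] obtain s1 a s2 where
      *: "s = s1 @ Some a # s2" "y = pos (s1 @ [Some a])" "a < q"
        "avoid (rev s1) [a]" "ends_at a (rel s2 [])" "\<not> cleared a s2 [] False" by blast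
    have "y = pos (take (Suc (length s1)) s)" using * by simp
    moreover have "length s1 \<in> ?K" using * by (auto simp: new_branch_def)
    ultimately show "y \<in> (\<lambda>k. pos (take (Suc k) s)) ` ?K" by blast
  qed
  then have "card (off_path s) \<le> card ((\<lambda>k. pos (take (Suc k) s)) ` ?K)"
    by (intro card_mono) auto
  also have "\<dots> \<le> card ?K" by (intro card_image_le) auto
  also have "\<dots> = (\<Sum>k<length s. of_bool (new_branch (take k s) (s ! k) (drop (Suc k) s)))"
    unfolding of_bool_def by (simp add: sum.If_cases Int_def)
  finally show ?thesis .
qed

definition branch_const :: real where "branch_const = 1 + cleared_lim False + cleared_lim True"

lemma branch_prob:
  assumes a: "a < q"
  shows "expect m (\<lambda>t. of_bool (ends_at a (rel t []) \<and> \<not> cleared a t [] False)) \<le>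
    1 / q - nu2_hat q p + branch_const * lam ^ m"
proof -
  have "expect m (\<lambda>t. of_bool (ends_at a (rel t []) \<and> \<not> cleared a t [] False)) =
      expect m (\<lambda>t. of_bool (ends_at a (rel t [])) - of_bool (cleared a t [] False))"
    using cleared_ends_at by (intro expect_cong) auto
  also have "\<dots> = expect m (\<lambda>t. of_bool (ends_at a (rel t []))) - expect m (\<lambda>t. of_bool (cleared a t [] False))"
    by (rule expect_diff)
  also have "\<dots> \<le> (chi_lim 1 a [] + lam ^ m) - (nu2_hat q p - (cleared_lim False + cleared_lim True) * lam ^ m)"
    using branch_limit[OF a, of "[]" m] cleared_limit[OF a, of m]
    by (intro diff_mono) (auto simp: abs_le_iff)
  also have "\<dots> = 1 / q - nu2_hat q p + branch_const * lam ^ m"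
    by (simp add: chi_lim_def sign_lim_1 branch_const_def algebra_simps)
  finally show ?thesis .
qed

text \<open>
  Reversal of the first \<open>k\<close> letters turns the probability that a vertex is new into an avoidance
  probability, with limit \<open>1 - F\<close>; the two error terms come from the past and from the future.
\<close>

lemma new_branch_prob:
  "expect (k + Suc m) (\<lambda>s. of_bool (new_branch (take k s) (s ! k) (drop (Suc k) s))) \<le>
   (1 - p) * (1 - F) * (1 / q - nu2_hat q p) + branch_const * lam ^ m + lam ^ k"
proof -
  define g where "g a = expect m (\<lambda>t. of_bool (ends_at a (rel t []) \<and> \<not> cleared a t [] False))" for a
  define A where "A a = expect k (\<lambda>s. of_bool (avoid s [a]))" for a
  have g: "0 \<le> g a" "g a \<le> 1" for a
    using expect_mono[of m "\<lambda>_. 0" "\<lambda>t. of_bool (ends_at a (rel t []) \<and> \<not> cleared a t [] False)"]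
      expect_mono[of m "\<lambda>t. of_bool (ends_at a (rel t []) \<and> \<not> cleared a t [] False)" "\<lambda>_. 1"]
    by (auto simp: g_def expect_const)
  have None: "of_bool (new_branch s None t) = (0 :: real)" for s t
    by (simp add: new_branch_def)
  have Some: "of_bool (new_branch s (Some a) t) = (of_bool (avoid (rev s) [a]) *
      of_bool (ends_at a (rel t []) \<and> \<not> cleared a t [] False) :: real)" if "a \<in> {..<q}" for s t a
    using that by (auto simp: new_branch_def)
  have "expect (k + Suc m) (\<lambda>s. of_bool (new_branch (take k s) (s ! k) (drop (Suc k) s))) =
      expect k (\<lambda>s. p * expect m (\<lambda>t. of_bool (new_branch s None t)) +
        move_prob * (\<Sum>a<q. expect m (\<lambda>t. of_bool (new_branch s (Some a) t))))"
    by (rule expect_split)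
  also have "\<dots> = expect k (\<lambda>s. move_prob * (\<Sum>a<q. g a * of_bool (avoid (rev s) [a])))"
    by (simp add: None Some expect_const expect_cmult g_def mult.commute)
  also have "\<dots> = move_prob * (\<Sum>a<q. g a * expect k (\<lambda>s. of_bool (avoid (rev s) [a])))"
    by (simp only: expect_cmult expect_sum)
  also have "\<dots> = move_prob * (\<Sum>a<q. g a * A a)"
    unfolding A_def expect_rev[of k "\<lambda>s. of_bool (avoid s [a])" for a] ..
  also have "\<dots> \<le> move_prob * (\<Sum>a<q. (1 - F) * (1 / q - nu2_hat q p) + branch_const * lam ^ m + lam ^ k)"
  proof (intro mult_left_mono sum_mono)
    fix a assume "a \<in> {..<q}"
    then have a: "a < q" by simp
    have "lam ^ k * rho \<le> lam ^ k * 1"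
      using rho_less lam_nonneg by (intro mult_left_mono) auto
    then have A: "A a \<le> (1 - F) + lam ^ k"
      using avoid_limit[of "[a]" k] a unfolding A_def by (simp add: abs_le_iff)
    have "g a * A a \<le> g a * ((1 - F) + lam ^ k)"
      using A g by (intro mult_left_mono) auto
    also have "\<dots> = (1 - F) * g a + g a * lam ^ k" by (simp add: algebra_simps)
    also have "\<dots> \<le> (1 - F) * (1 / q - nu2_hat q p + branch_const * lam ^ m) + 1 * lam ^ k"
      using branch_prob[OF a, of m] g lam_nonneg F_less unfolding g_def[symmetric]
      by (intro add_mono mult_left_mono mult_right_mono) auto
    also have "\<dots> = (1 - F) * (1 / q - nu2_hat q p) + (1 - F) * (branch_const * lam ^ m) + lam ^ k"
      by (simp add: algebra_simps)
    also have "(1 - F) * (branch_const * lam ^ m) \<le> 1 * (branch_const * lam ^ m)"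
      using F_pos lam_nonneg cleared_lim_nonneg by (intro mult_right_mono) (auto simp: branch_const_def)
    finally show "g a * A a \<le> (1 - F) * (1 / q - nu2_hat q p) + branch_const * lam ^ m + lam ^ k"
      by simp
  qed (use move_prob_pos in auto)
  also have "\<dots> = (1 - p) * (1 - F) * (1 / q - nu2_hat q p) + (1 - p) * (branch_const * lam ^ m + lam ^ k)"
  proof -
    have const: "move_prob * (\<Sum>a<q. c) = (1 - p) * c" for c :: real
      unfolding move_prob_q[symmetric] by simp
    have "z * (y * x + b + c) = z * y * x + z * (b + c)" for x y z b c :: real
      by (simp add: algebra_simps)
    then show ?thesis unfolding const .
  qed
  also have "(1 - p) * (branch_const * lam ^ m + lam ^ k) \<le> 1 * (branch_const * lam ^ m + lam ^ k)"
    using p_pos lam_nonneg cleared_lim_nonneg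
    by (intro mult_right_mono) (auto simp: branch_const_def)
  finally show ?thesis by simp
qed

text \<open>
  The errors at time \<open>k\<close> are geometric in \<open>k\<close> and in \<open>n - k\<close>, so their sum stays bounded.
\<close>

lemma off_path_upper:
  "expect n (\<lambda>s. real (card (off_path s))) \<le>
   real n * ((1 - p) * (1 - F) * (1 / q - nu2_hat q p)) + (branch_const + 1) / (1 - lam)"
proof -
  let ?b = "\<lambda>k s. of_bool (new_branch (take k s) (s ! k) (drop (Suc k) s)) :: real"
  have "expect n (\<lambda>s. real (card (off_path s))) \<le> expect n (\<lambda>s. \<Sum>k<n. ?b k s)"
  proof (rule expect_mono)
    fix s assume "set s \<subseteq> letters q" "length s = n"
    then have "real (card (off_path s)) \<le> real (\<Sum>k<n. of_bool (new_branch (take k s) (s ! k) (drop (Suc k) s)))"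
      using card_off_path_le[of s] unfolding of_nat_le_iff by simp
    then show "real (card (off_path s)) \<le> (\<Sum>k<n. ?b k s)" by simp
  qed
  also have "\<dots> = (\<Sum>k<n. expect n (?b k))" by (rule expect_sum)
  also have "\<dots> \<le> (\<Sum>k<n. (1 - p) * (1 - F) * (1 / q - nu2_hat q p) +
      branch_const * lam ^ (n - Suc k) + lam ^ k)"
  proof (rule sum_mono)
    fix k assume "k \<in> {..<n}"
    then have "k + Suc (n - Suc k) = n" by simp
    then show "expect n (?b k) \<le> (1 - p) * (1 - F) * (1 / q - nu2_hat q p) +
        branch_const * lam ^ (n - Suc k) + lam ^ k"
      using new_branch_prob[of k "n - Suc k"] by simp
  qed
  also have "\<dots> = real n * ((1 - p) * (1 - F) * (1 / q - nu2_hat q p)) +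
      (branch_const + 1) * (\<Sum>k<n. lam ^ k)"
  proof -
    have "(\<Sum>k<n. c + b * lam ^ (n - Suc k) + lam ^ k) =
        real n * c + b * (\<Sum>k<n. lam ^ (n - Suc k)) + (\<Sum>k<n. lam ^ k)" for b c :: real
      by (simp add: sum.distrib sum_distrib_left)
    then show ?thesis
      unfolding sum.nat_diff_reindex[of "\<lambda>k. lam ^ k" n] by (simp add: distrib_right)
  qed
  also have "\<dots> \<le> real n * ((1 - p) * (1 - F) * (1 / q - nu2_hat q p)) +
      (branch_const + 1) * (1 / (1 - lam))"
    using geometric_sum_le[OF lam_nonneg lam_less, of n] cleared_lim_nonneg
    by (intro add_left_mono mult_left_mono) (auto simp: branch_const_def)
  finally show ?thesis by simp
qed

end


section \<open>Word length in the lamplighter group\<close>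

lemma word_mult_rev_append: "word_mult (rev u) (u @ t) = t"
  by (induction u) (auto simp: word_mult_append word_mult_Cons)

fun emb :: "nat option \<Rightarrow> lamplighter_state" where
  "emb None = switch"
| "emb (Some a) = ((\<lambda>_. 0), [a])"

text \<open>
  \<open>|x| + |S| + 2 |S - [o,x]|\<close>, written with the part of \<open>S\<close> on the geodesic.
\<close>

definition Phi :: "lamplighter_state \<Rightarrow> real" where
  "Phi g = (case g of (\<eta>, x) \<Rightarrow>
     real (length x) + 3 * real (card {w. \<eta> w \<noteq> 0}) - 2 * real (card {w. \<eta> w \<noteq> 0 \<and> prefix w x}))"

lemma emb_image: "emb ` letters q = insert switch (moves q)"
  by (auto simp: letters_def moves_def image_iff)

text \<open>
  Extending the geodesic by a vertex adds \<open>1\<close> to the length and removes \<open>2\<close> if the lamp at the new vertex is lit.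
\<close>

lemma Phi_snoc:
  assumes "finite {w. \<eta> w \<noteq> 0}"
  shows "\<bar>Phi (\<eta>, x @ [a]) - Phi (\<eta>, x)\<bar> \<le> 1"
proof -
  let ?S = "{w. \<eta> w \<noteq> 0}" and ?P = "\<lambda>x. {w. \<eta> w \<noteq> 0 \<and> prefix w x}"
  have "?P (x @ [a]) = (if \<eta> (x @ [a]) \<noteq> 0 then insert (x @ [a]) (?P x) else ?P x)"
    by auto
  moreover have "finite (?P x)" "x @ [a] \<notin> ?P x"
    using assms by (auto simp: prefix_def)
  ultimately have "real (card (?P (x @ [a]))) = real (card (?P x)) + (if \<eta> (x @ [a]) \<noteq> 0 then 1 else 0)"
    by simp
  then show ?thesis by (simp add: Phi_def)
qed

context lamplighter_walk
begin

abbreviation "base \<equiv> tree_group q"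
abbreviation "lamp_group \<equiv> tree_lamplighter q"

definition state :: "nat option list \<Rightarrow> lamplighter_state" where
  "state s = ((\<lambda>w. if w \<in> lit_set s then 1 else 0), pos s)"

lemma group_lamp_group: "group lamp_group"
  unfolding tree_lamplighter_def by (rule group_lamplighter[OF group_tree_group])

lemma carrier_lamp_group: "carrier lamp_group = lamp_configs base \<times> reduced_words q"
  by (simp add: tree_lamplighter_def lamplighter_def tree_group_def)

lemma mult_lamp_group: "(\<eta>, x) \<otimes>\<^bsub>lamp_group\<^esub> (\<theta>, y) = (\<lambda>w. \<eta> w + translate base x \<theta> w, word_mult x y)"
  by (simp add: tree_lamplighter_def lamplighter_def tree_group_def)

lemma one_lamp_group: "\<one>\<^bsub>lamp_group\<^esub> = ((\<lambda>_. 0), [])"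
  by (simp add: tree_lamplighter_def lamplighter_def tree_group_def)

lemma inv_base: "x \<in> reduced_words q \<Longrightarrow> inv\<^bsub>base\<^esub> x = rev x"
  by (rule group.inv_equality[OF group_tree_group])
    (simp_all add: tree_group_def word_mult_rev_left rev_reduced)

lemma translate_base: "x \<in> reduced_words q \<Longrightarrow>
  translate base x \<theta> w = (if w \<in> reduced_words q then \<theta> (word_mult (rev x) w) else 0)"
  by (simp add: translate_def inv_base) (simp add: tree_group_def)

lemma switch_config: "((\<lambda>w. if w = [] then 1 else 0) :: nat list \<Rightarrow> bit) \<in> lamp_configs base"
  by (simp add: lamp_configs_def tree_group_def)

lemma emb_carrier: "x \<in> letters q \<Longrightarrow> emb x \<in> carrier lamp_group"
  using switch_config
  by (auto simp: letters_def carrier_lamp_group switch_def) (simp add: lamp_configs_def)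

lemma state_carrier: "set s \<subseteq> letters q \<Longrightarrow> state s \<in> carrier lamp_group"
proof -
  assume s: "set s \<subseteq> letters q"
  have "{w. (if w \<in> lit_set s then 1 else 0 :: bit) \<noteq> 0} = lit_set s" by auto
  then show ?thesis
    using finite_lit_set[OF s] pos_reduced[OF s]
    by (auto simp: state_def carrier_lamp_group lamp_configs_def tree_group_def lit_set_def)
qed

lemma state_Cons:
  assumes "x \<in> letters q" "set s \<subseteq> letters q"
  shows "state (x # s) = emb x \<otimes>\<^bsub>lamp_group\<^esub> state s"
proof (cases x)
  case None
  have "(if w \<in> lit_set (None # s) then 1 else 0 :: bit) =
      (if w = [] then 1 else 0) + translate base [] (\<lambda>w. if w \<in> lit_set s then 1 else 0) w" for w
    by (cases "w = []"; cases "lit s w") (auto simp: translate_base lit_set_def)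
  then show ?thesis
    by (simp add: None state_def switch_def mult_lamp_group del: add_bit_eq_xor)
next
  case (Some a)
  then have a: "a < q" using assms by (auto simp: letters_def)
  have "(if w \<in> lit_set (Some a # s) then 1 else 0 :: bit) =
      0 + translate base [a] (\<lambda>w. if w \<in> lit_set s then 1 else 0) w" for w
    using a by (auto simp: translate_base lit_set_def word_mult_Cons letter_mult_reduced)
  then show ?thesis
    by (simp add: Some state_def mult_lamp_group word_mult_Cons del: add_bit_eq_xor)
qed

lemma state_Nil: "state [] = \<one>\<^bsub>lamp_group\<^esub>"
  by (simp add: state_def one_lamp_group lit_set_def)

lemma state_append:
  assumes "set s \<subseteq> letters q" "set t \<subseteq> letters q"
  shows "state (s @ t) = state s \<otimes>\<^bsub>lamp_group\<^esub> state t"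
  using assms(1)
proof (induction s)
  case Nil
  then show ?case
    using group.is_monoid[OF group_lamp_group] state_carrier[OF assms(2)]
    by (simp add: state_Nil monoid.l_one)
next
  case (Cons x s)
  then show ?case
    using group.is_monoid[OF group_lamp_group] assms(2)
    by (simp add: state_Cons monoid.m_assoc[OF _ emb_carrier state_carrier state_carrier])
qed

lemma state_snoc:
  assumes "set s \<subseteq> letters q" "x \<in> letters q"
  shows "state (s @ [x]) = state s \<otimes>\<^bsub>lamp_group\<^esub> emb x"
proof -
  have "state [x] = emb x"
    using state_Cons[OF assms(2), of "[]"] group.is_monoid[OF group_lamp_group] emb_carrier[OF assms(2)]
    by (simp add: state_Nil monoid.r_one)
  then show ?thesis using state_append[OF assms(1), of "[x]"] assms(2) by simp
qed

abbreviation "edges \<equiv> cayley_edges lamp_group (insert switch (moves q))"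

lemma edges_emb: "edges = {(g, g \<otimes>\<^bsub>lamp_group\<^esub> emb x) | g x. g \<in> carrier lamp_group \<and> x \<in> letters q} \<union>
    {(g, g \<otimes>\<^bsub>lamp_group\<^esub> emb x) | g x. g \<in> carrier lamp_group \<and> x \<in> letters q}\<inverse>"
  unfolding cayley_edges_def emb_image[symmetric] Let_def by blast

lemma state_path: "set s \<subseteq> letters q \<Longrightarrow> (state s, \<one>\<^bsub>lamp_group\<^esub>) \<in> edges ^^ length s"
proof (induction s rule: rev_induct)
  case Nil
  then show ?case by (simp add: state_Nil)
next
  case (snoc x s)
  then have "state s \<in> carrier lamp_group" "x \<in> letters q" using state_carrier[of s] by auto
  then have "(state s \<otimes>\<^bsub>lamp_group\<^esub> emb x, state s) \<in> edges"
    unfolding edges_emb by (intro UnI2 converseI CollectI exI conjI) (rule refl)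
  then have "(state (s @ [x]), state s) \<in> edges" using snoc by (simp add: state_snoc)
  moreover have "(state s, \<one>\<^bsub>lamp_group\<^esub>) \<in> edges ^^ length s" using snoc by simp
  ultimately show ?case by (simp add: relpow_Suc_I2 del: relpow.simps)
qed

lemma length_le: "set s \<subseteq> letters q \<Longrightarrow> lamplighter_length q (state s) \<le> length s"
  unfolding lamplighter_length_def cayley_length_def by (rule Least_le) (rule state_path)

lemma length_attained:
  "set s \<subseteq> letters q \<Longrightarrow> (state s, \<one>\<^bsub>lamp_group\<^esub>) \<in> edges ^^ lamplighter_length q (state s)"
  unfolding lamplighter_length_def cayley_length_def by (rule LeastI) (rule state_path)

text \<open>
  The present position is always on its own geodesic, so a switch changes \<open>|S|\<close> and the part of \<open>S\<close> on
  the geodesic together, with net effect \<open>\<plusminus>1\<close>.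
\<close>

lemma Phi_generator:
  assumes g: "g \<in> carrier lamp_group" and x: "x \<in> letters q"
  shows "\<bar>Phi (g \<otimes>\<^bsub>lamp_group\<^esub> emb x) - Phi g\<bar> \<le> 1"
proof -
  obtain \<eta> y where [simp]: "g = (\<eta>, y)" by force
  have y: "y \<in> reduced_words q" and fin: "finite {w. \<eta> w \<noteq> 0}"
    using g by (auto simp: carrier_lamp_group lamp_configs_def)
  show ?thesis
  proof (cases x)
    case None
    define \<theta> where "\<theta> w = \<eta> w + translate base y (\<lambda>w. if w = [] then 1 else 0) w" for w
    have "word_mult (rev y) w = [] \<longleftrightarrow> w = y" if "w \<in> reduced_words q" for w
    proof
      assume "word_mult (rev y) w = []"
      then have "word_mult y (word_mult (rev y) w) = y"
        using word_mult_Nil_right y by (simp add: reduced_words_def)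
      moreover have "word_mult y (rev y) = []"
        using word_mult_rev_left[of "rev y"] by simp
      ultimately show "w = y"
        using word_mult_assoc[OF y rev_reduced[OF y] that] by simp
    qed (simp add: word_mult_rev_left)
    then have \<theta>: "\<theta> w = \<eta> w + (if w = y then 1 else 0)" for w
      using y by (simp add: \<theta>_def translate_base)
    have set: "{w. \<theta> w \<noteq> 0 \<and> P w} = (if y \<in> {w. \<eta> w \<noteq> 0 \<and> P w}
        then {w. \<eta> w \<noteq> 0 \<and> P w} - {y} else insert y {w. \<eta> w \<noteq> 0 \<and> P w})" if "P y" for P
      using that by (cases "\<eta> y") (auto simp: \<theta>)
    have card: "real (card {w. \<theta> w \<noteq> 0 \<and> P w}) = real (card {w. \<eta> w \<noteq> 0 \<and> P w}) +
        (1 - 2 * of_bool (\<eta> y \<noteq> 0))" if "P y" for P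
      using card_toggle[of "{w. \<eta> w \<noteq> 0 \<and> P w}" y] fin that
      unfolding set[of P, OF that] by simp
    have "g \<otimes>\<^bsub>lamp_group\<^esub> emb x = (\<theta>, y)"
      using y word_mult_Nil_right
      by (simp add: None switch_def mult_lamp_group \<theta>_def reduced_words_def fun_eq_iff)
    moreover have "Phi (\<theta>, y) = Phi (\<eta>, y) + (1 - 2 * of_bool (\<eta> y \<noteq> 0))"
      using card[of "\<lambda>_. True"] card[of "\<lambda>w. prefix w y"] by (simp add: Phi_def)
    ultimately show ?thesis by simp
  next
    case (Some a)
    then have a: "a < q" using x by (auto simp: letters_def)
    have prod: "g \<otimes>\<^bsub>lamp_group\<^esub> emb x = (\<eta>, word_mult y [a])"
      using y by (simp add: Some mult_lamp_group translate_base del: add_bit_eq_xor)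
    show ?thesis
    proof (cases "y \<noteq> [] \<and> last y = a")
      case True
      then obtain z where z: "y = z @ [a]" by (metis append_butlast_last_id)
      have "word_mult y [a] = z"
        using y word_mult_Nil_right[of z]
        by (simp add: z word_mult_append word_mult_Cons reduced_words_def distinct_adj_append_iff)
      then show ?thesis unfolding prod using Phi_snoc[OF fin, of z a] z by (simp add: abs_minus_commute)
    next
      case False
      have "distinct_adj (y @ [a])"
        using y False by (auto simp: reduced_words_def distinct_adj_append_iff)
      from word_mult_Nil_right[OF this] have "word_mult y [a] = y @ [a]"
        by (simp add: word_mult_append word_mult_Cons)
      then show ?thesis unfolding prod using Phi_snoc[OF fin, of y a] by simp
    qed
  qed
qed

lemma Phi_edge: "(g, h) \<in> edges \<Longrightarrow> \<bar>Phi g - Phi h\<bar> \<le> 1"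
  using Phi_generator unfolding edges_emb by (auto simp: abs_minus_commute)

lemma Phi_path: "(g, h) \<in> edges ^^ n \<Longrightarrow> \<bar>Phi g - Phi h\<bar> \<le> real n"
proof (induction n arbitrary: h)
  case (Suc n)
  then obtain k where "(g, k) \<in> edges ^^ n" "(k, h) \<in> edges" by (auto elim: relpow_Suc_E)
  then show ?case using Suc.IH[of k] Phi_edge[of k h] by simp
qed simp

text \<open>
  The potential vanishes at the identity and changes by at most \<open>1\<close> along each edge of the Cayley graph.
\<close>

lemma length_ge:
  assumes s: "set s \<subseteq> letters q"
  shows "real (length (pos s)) + 3 * real (card (lit_set s)) - 2 * real (card (lit_on_path s))
    \<le> real (lamplighter_length q (state s))"
proof -
  have "{w. (if w \<in> lit_set s then 1 else 0 :: bit) \<noteq> 0} = lit_set s"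
    "{w. (if w \<in> lit_set s then 1 else 0 :: bit) \<noteq> 0 \<and> prefix w (pos s)} = lit_on_path s"
    by (auto simp: lit_on_path_def)
  then have "Phi (state s) = real (length (pos s)) + 3 * real (card (lit_set s)) - 2 * real (card (lit_on_path s))"
    by (simp add: Phi_def state_def)
  moreover have "Phi \<one>\<^bsub>lamp_group\<^esub> = 0" by (simp add: Phi_def one_lamp_group)
  ultimately show ?thesis using Phi_path[OF length_attained[OF s]] by simp
qed

text \<open>
  A finite subtree \<open>K\<close> containing the root can be toured from the root to \<open>x\<close> by crossing the edges on the
  geodesic once and all others twice.  The induction removes a vertex \<open>y\<close> of maximal depth, which is a leaf, and inserts
  a detour to \<open>y\<close> at a visit of its parent; for this the tour has to meet every vertex of \<open>K\<close>.  If
  the tour is to end at \<open>y\<close>, the detour is put last and its way back is dropped.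
\<close>

lemma tour:
  assumes "finite K" "K \<subseteq> reduced_words q" "[] \<in> K" "\<And>y b. y @ [b] \<in> K \<Longrightarrow> y \<in> K"
    and "x \<in> K" "\<eta> \<subseteq> K"
  shows "\<exists>s. set s \<subseteq> letters q \<and> pos s = x \<and> lit_set s = \<eta> \<and>
    (\<forall>y\<in>K. \<exists>s1 s2. s = s1 @ s2 \<and> pos s1 = y) \<and>
    length s + length x + 2 \<le> card \<eta> + 2 * card K"
  using assms
proof (induction "card K" arbitrary: K x \<eta> rule: less_induct)
  case less
  show ?case
  proof (cases "K = {[]}")
    case True
    then consider "\<eta> = {}" | "\<eta> = {[]}" using less.prems by blast
    then show ?thesis
    proof cases
      case 1
      then show ?thesis using True less.prems
        by (intro exI[of _ "[]"]) (auto simp: lit_set_def)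
    next
      case 2
      have "\<exists>s1 s2. [None] = s1 @ s2 \<and> pos s1 = []"
        by (rule exI[of _ "[]"]) simp
      moreover have "lit_set [None] = {[]}" by (auto simp: lit_set_def)
      moreover have "x = []" using True less.prems by simp
      ultimately show ?thesis unfolding True 2
        by (intro exI[of _ "[None]"]) (simp add: letters_def)
    qed
  next
    case False
    obtain y where y: "y \<in> K" "\<And>z. z \<in> K \<Longrightarrow> length z \<le> length y"
    proof -
      have "Max (length ` K) \<in> length ` K" using less.prems by (intro Max_in) auto
      then obtain y where "y \<in> K" "length y = Max (length ` K)" by auto
      then show thesis using that less.prems(1) by (metis Max_ge finite_imageI imageI)
    qed
    have "y \<noteq> []"
    proof
      assume "y = []"
      then have "K \<subseteq> {[]}" using y(2) by fastforce
      then show False using False less.prems(3) by blast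
    qed
    then obtain y0 b where yb: "y = y0 @ [b]" by (metis append_butlast_last_id)
    have yr: "y \<in> reduced_words q" using y less.prems by blast
    then have b: "b < q" by (auto simp: yb reduced_words_def)
    have y0: "y0 \<in> K - {y}" using less.prems(4)[of y0 b] y(1) by (auto simp: yb)
    then have y0r: "y0 \<in> reduced_words q" using less.prems by blast
    define x' where "x' = (if x = y then y0 else x)"
    have "card (K - {y}) < card K" using y less.prems by (intro psubset_card_mono) auto
    moreover have "z \<in> K - {y}" if "z @ [c] \<in> K - {y}" for z c
      using less.prems(4)[of z c] y(2)[of "z @ [c]"] that by auto
    moreover have "finite (K - {y})" "K - {y} \<subseteq> reduced_words q" "[] \<in> K - {y}"
        "x' \<in> K - {y}" "\<eta> - {y} \<subseteq> K - {y}"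
      using less.prems(1-3,5,6) y0 \<open>y \<noteq> []\<close> by (auto simp: x'_def)
    ultimately have "\<exists>s. set s \<subseteq> letters q \<and> pos s = x' \<and> lit_set s = \<eta> - {y} \<and>
        (\<forall>z\<in>K - {y}. \<exists>s1 s2. s = s1 @ s2 \<and> pos s1 = z) \<and>
        length s + length x' + 2 \<le> card (\<eta> - {y}) + 2 * card (K - {y})"
      by (intro less.hyps)
    then obtain s where s: "set s \<subseteq> letters q" "pos s = x'" "lit_set s = \<eta> - {y}"
        "\<And>z. z \<in> K - {y} \<Longrightarrow> \<exists>s1 s2. s = s1 @ s2 \<and> pos s1 = z"
        "length s + length x' + 2 \<le> card (\<eta> - {y}) + 2 * card (K - {y})"
      by blast
    obtain s1 s2 where sp: "s = s1 @ s2" "pos s1 = y0" "x = y \<longrightarrow> s2 = []"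
    proof (cases "x = y")
      case True
      then show thesis using that[of s "[]"] s by (simp add: x'_def)
    next
      case False
      then show thesis using that s(4)[OF y0] by blast
    qed
    define D :: "nat option list" where "D = (if y \<in> \<eta> then [None] else [])"
    define t2 where "t2 = (if x = y then [] else Some b # s2)"
    define t where "t = s1 @ Some b # D @ t2"
    have Dl: "set D \<subseteq> letters q" "rel D v = v" "lit D v \<longleftrightarrow> y \<in> \<eta> \<and> v = []" for v
      by (auto simp: D_def letters_def)
    have s12: "set s1 \<subseteq> letters q" "set s2 \<subseteq> letters q" using s(1) sp by auto
    have tl: "set t \<subseteq> letters q"
      using s12 Dl b by (auto simp: t_def t2_def letters_def)
    have bb: "letter_mult b (letter_mult b v) = v" if "v \<in> reduced_words q" for v
      using that by (simp add: letter_mult_twice reduced_words_def)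
    have r1: "rel s1 v \<in> reduced_words q" if "v \<in> reduced_words q" for v
      using rel_reduced[OF s12(1) that] .
    have r1y: "rel s1 y = [b]"
      using rel_conv_pos[OF s12(1) yr] sp by (simp add: yb word_mult_rev_append)
    have rel_back: "rel (s1 @ Some b # D @ Some b # r) v = rel (s1 @ r) v" if "v \<in> reduced_words q" for r v
      using that bb[OF r1] Dl by (simp add: rel_append)
    have lit_t: "lit t v \<longleftrightarrow> (lit s v \<noteq> (y \<in> \<eta> \<and> v = y))" if v: "v \<in> reduced_words q" for v
    proof -
      have "letter_mult b (rel s1 v) = [] \<longleftrightarrow> rel s1 v = [b]"
        using bb[OF r1[OF v]] by (metis letter_mult.simps)
      also have "\<dots> \<longleftrightarrow> v = y"
        using rel_inject[OF s12(1) v yr] r1y by simp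
      finally have "lit D (letter_mult b (rel s1 v)) \<longleftrightarrow> y \<in> \<eta> \<and> v = y"
        using Dl by simp
      moreover have "lit t2 (letter_mult b (rel s1 v)) = lit s2 (rel s1 v)"
        using bb[OF r1[OF v]] sp by (auto simp: t2_def)
      ultimately show ?thesis
        using Dl by (auto simp: t_def lit_append sp)
    qed
    have "lit_set t = \<eta>"
    proof -
      have "lit s v \<longleftrightarrow> v \<in> \<eta> \<and> v \<noteq> y" if "v \<in> reduced_words q" for v
        using s(3) that by (auto simp: lit_set_def)
      then have "v \<in> lit_set t \<longleftrightarrow> v \<in> reduced_words q \<and> v \<in> \<eta>" for v
        using lit_t by (auto simp: lit_set_def)
      then show ?thesis using less.prems by blast
    qed
    moreover have "pos t = x"
    proof -
      have xr: "x \<in> reduced_words q" using less.prems by blast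
      have "rel t x = []"
      proof (cases "x = y")
        case True
        then show ?thesis using r1y Dl by (simp add: t_def t2_def rel_append)
      next
        case False
        then have "rel t x = rel s x" using rel_back[OF xr] sp by (simp add: t_def t2_def)
        then show ?thesis using rel_pos[OF s(1)] s(2) False by (simp add: x'_def)
      qed
      then show ?thesis using rel_eq_Nil_iff[OF tl xr] by simp
    qed
    moreover have "\<exists>u w. t = u @ w \<and> pos u = z" if z: "z \<in> K" for z
    proof (cases "z = y")
      case True
      have "rel (s1 @ [Some b]) y = []" using r1y by (simp add: rel_append)
      then have "pos (s1 @ [Some b]) = y"
        using rel_eq_Nil_iff[of "s1 @ [Some b]" q y] s12 b yr by (simp add: letters_def)
      then show ?thesis
        using True by (intro exI[of _ "s1 @ [Some b]"] exI[of _ "D @ t2"]) (simp add: t_def)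
    next
      case False
      have zr: "z \<in> reduced_words q" using z less.prems by blast
      obtain u w where uw: "s = u @ w" "pos u = z" using s(4)[of z] z False by blast
      then have "s1 @ s2 = u @ w" using sp by simp
      then consider r where "s1 = u @ r" | r where "u = s1 @ r" "s2 = r @ w"
        by (auto simp: append_eq_append_conv2)
      then show ?thesis
      proof cases
        case 1
        then show ?thesis
          using uw by (intro exI[of _ u] exI[of _ "r @ Some b # D @ t2"]) (simp add: t_def)
      next
        case 2
        show ?thesis
        proof (cases "x = y")
          case True
          then show ?thesis
            using 2 sp uw by (intro exI[of _ u] exI[of _ "Some b # D @ t2"]) (simp add: t_def)
        next
          case False
          let ?u = "s1 @ Some b # D @ Some b # r"
          have ul: "set u \<subseteq> letters q" using uw s(1) by simp
          have "rel ?u z = []"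
            using rel_back[OF zr] rel_pos[OF ul] uw 2 by simp
          moreover have "set ?u \<subseteq> letters q"
            using tl 2 False by (auto simp: t_def t2_def)
          ultimately have "pos ?u = z" using rel_eq_Nil_iff[OF _ zr] by blast
          then show ?thesis
            using 2 False by (intro exI[of _ ?u] exI[of _ w]) (simp add: t_def t2_def)
        qed
      qed
    qed
    moreover have "length t + length x + 2 \<le> card \<eta> + 2 * card K"
    proof -
      have "card K = Suc (card (K - {y}))"
        using y less.prems card.remove by metis
      moreover have "finite \<eta>" using less.prems finite_subset by blast
      then have "card \<eta> = card (\<eta> - {y}) + length D"
        using card.remove[of \<eta> y] by (auto simp: D_def)
      moreover have "length t + length x = length s + length x' + 2 + length D"
        using sp by (auto simp: t_def t2_def x'_def yb)
      ultimately show ?thesis using s(5) by simp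
    qed
    ultimately show ?thesis using tl by blast
  qed
qed

text \<open>
  The subtree spanned by the root, the position and the lit lamps consists of the geodesic and \<open>off_path\<close>.
\<close>

lemma length_upper:
  assumes s: "set s \<subseteq> letters q"
  shows "lamplighter_length q (state s) \<le> card (lit_set s) + length (pos s) + 2 * card (off_path s)"
proof -
  define K where "K = {y \<in> reduced_words q. \<exists>z \<in> insert (pos s) (lit_set s). prefix y z}"
  have "off_path s \<subseteq> (\<Union>z\<in>lit_set s. set (prefixes z))" by (auto simp: off_path_def)
  then have fO: "finite (off_path s)"
    by (rule finite_subset) (use finite_lit_set[OF s] in auto)
  have sub: "K \<subseteq> set (prefixes (pos s)) \<union> off_path s"
    by (auto simp: K_def off_path_def)
  then have fK: "finite K" by (rule finite_subset) (use fO in auto)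
  have "card K \<le> card (set (prefixes (pos s))) + card (off_path s)"
    using card_mono[OF _ sub] card_Un_le[of "set (prefixes (pos s))" "off_path s"] fO by simp
  also have "card (set (prefixes (pos s))) \<le> length (pos s) + 1"
    using card_length[of "prefixes (pos s)"] by simp
  finally have cK: "card K \<le> length (pos s) + 1 + card (off_path s)" by simp
  have "\<exists>t. set t \<subseteq> letters q \<and> pos t = pos s \<and> lit_set t = lit_set s \<and>
    (\<forall>y\<in>K. \<exists>s1 s2. t = s1 @ s2 \<and> pos s1 = y) \<and>
    length t + length (pos s) + 2 \<le> card (lit_set s) + 2 * card K"
  proof (rule tour[OF fK])
    fix y b assume "y @ [b] \<in> K"
    then show "y \<in> K"
      by (auto simp: K_def reduced_words_def distinct_adj_append_iff dest: append_prefixD)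
  qed (use pos_reduced[OF s] in \<open>auto simp: K_def lit_set_def\<close>)
  then obtain t where t: "set t \<subseteq> letters q" "pos t = pos s" "lit_set t = lit_set s"
      "length t + length (pos s) + 2 \<le> card (lit_set s) + 2 * card K" by blast
  have "state t = state s" using t by (simp add: state_def)
  then show ?thesis using length_le[OF t(1)] t(4) cK by simp
qed


section \<open>The rate of escape\<close>

lemma sign_lim_neg: "1 - 2 * nu = (1 - p) * (real q - 2) / (p * real q + real q - 2)"
  and nu_eq: "nu / q = p * (real q - 1) / (p * real q + real q - 2) / q"
  and escape_eq: "(1 - p) * (1 - F) = (1 - p) * (real q - 2) / (real q - 1)"
proof -
  have q: "real q \<ge> 3" using q3 by simp
  then have q1: "real q - 1 \<noteq> 0" and q2: "real q - 2 > 0" by auto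
  have "0 < p * real q" using q p_pos by simp
  then have D: "p * real q + real q - 2 > 0" using q by simp
  have F: "F = 1 / (real q - 1)" by (rule F_def)
  show escape: "(1 - p) * (1 - F) = (1 - p) * (real q - 2) / (real q - 1)"
    unfolding F using q1 by (simp add: field_simps)
  have den: "1 - (- 1) * p - (1 - p) * F = (p * real q + real q - 2) / (real q - 1)"
    unfolding F using q1 by (simp add: field_simps)
  have "1 - 2 * nu = sign_lim (- 1)" unfolding nu_def by argo
  also have "\<dots> = (1 - p) * (real q - 2) / (p * real q + real q - 2)"
    unfolding sign_lim_def escape den using q1 by simp
  finally show e: "1 - 2 * nu = (1 - p) * (real q - 2) / (p * real q + real q - 2)" .
  have "nu = (1 - (1 - p) * (real q - 2) / (p * real q + real q - 2)) / 2"
    using e by simp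
  also have "\<dots> = p * (real q - 1) / (p * real q + real q - 2)"
    using D by (simp add: field_simps)
  finally show "nu / q = p * (real q - 1) / (p * real q + real q - 2) / q" by simp
qed

lemma move_prob_times: "move_prob * x = (1 - p) * x / q"
  by (simp add: move_prob_def)

text \<open>
  The three terms are the speed of the walk on the tree, the lit lamps, and twice the lit lamps off the geodesic.
\<close>

lemma expected_length_lower:
  "\<exists>C. \<forall>n. real n * ((1 - p) * (real q - 2) / real q *
      ((real q - 2 + 2 * p * (real q + 1)) / (p * real q + real q - 2))) - C
    \<le> expect n (\<lambda>s. real (lamplighter_length q (state s)))"
proof -
  define A where "A = move_prob * (real q - 2) + 3 * (p * (1 - 2 * nu)) -
      2 * (p * (1 - 2 * nu) - (1 - p) * (1 - F) * nu / q)"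
  define C where "C = 3 * (2 * (real q + 1) / (1 - lam)) + 2 * ((2 * (real q + 1) + 2) / (1 - lam))"
  have "real n * A - C \<le> expect n (\<lambda>s. real (lamplighter_length q (state s)))" for n
  proof -
    have "real n * A - C = real n * (move_prob * (real q - 2)) +
        3 * (real n * (p * (1 - 2 * nu)) - 2 * (real q + 1) / (1 - lam)) -
        2 * (real n * (p * (1 - 2 * nu) - (1 - p) * (1 - F) * nu / q) + (2 * (real q + 1) + 2) / (1 - lam))"
      unfolding A_def C_def by (simp add: distrib_left right_diff_distrib)
    also have "\<dots> \<le> expect n (\<lambda>s. real (length (pos s))) + 3 * expect n (\<lambda>s. real (card (lit_set s))) -
        2 * expect n (\<lambda>s. real (card (lit_on_path s)))"
      by (intro diff_mono add_mono mult_left_mono distance_lower lit_lower on_path_upper) auto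
    also have "\<dots> = expect n (\<lambda>s. real (length (pos s)) + 3 * real (card (lit_set s)) - 2 * real (card (lit_on_path s)))"
      by (simp only: expect_add expect_diff expect_cmult)
    also have "\<dots> \<le> expect n (\<lambda>s. real (lamplighter_length q (state s)))"
      by (intro expect_mono length_ge)
    finally show ?thesis .
  qed
  moreover have "A = (1 - p) * (real q - 2) / real q *
      ((real q - 2 + 2 * p * (real q + 1)) / (p * real q + real q - 2))"
  proof -
    have q: "real q \<ge> 3" using q3 by simp
    have "0 < p * real q" using q p_pos by simp
    then have D: "p * real q + real q - 2 > 0" using q by simp
    have "A = move_prob * (real q - 2) + p * (1 - 2 * nu) + 2 * ((1 - p) * (1 - F) * (nu / q))"
      by (simp add: A_def)
    also have "\<dots> = (1 - p) * (real q - 2) / real q *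
      ((real q - 2 + 2 * p * (real q + 1)) / (p * real q + real q - 2))"
      unfolding sign_lim_neg nu_eq escape_eq move_prob_times using D q by (simp add: divide_simps) algebra
    finally show ?thesis .
  qed
  ultimately show ?thesis by blast
qed

lemma expected_length_upper:
  "\<exists>C. \<forall>n. expect n (\<lambda>s. real (lamplighter_length q (state s))) \<le>
    real n * ((1 - p) * (real q - 2) / real q *
      ((real q + 1) / (real q - 1) - 2 * real q / (real q - 1) * nu2_hat q p
        + p * real q / (p * real q + real q - 2))) + C"
proof -
  define B where "B = p * (1 - 2 * nu) + move_prob * (real q - 2) +
      2 * ((1 - p) * (1 - F) * (1 / q - nu2_hat q p))"
  define C where "C = 2 * (real q + 1) / (1 - lam) + 2 * move_prob / (1 - lam) +
      2 * ((branch_const + 1) / (1 - lam))"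
  have "expect n (\<lambda>s. real (lamplighter_length q (state s))) \<le> real n * B + C" for n
  proof -
    have "expect n (\<lambda>s. real (lamplighter_length q (state s))) \<le>
        expect n (\<lambda>s. real (card (lit_set s)) + real (length (pos s)) + 2 * real (card (off_path s)))"
    proof (rule expect_mono)
      fix s assume "set s \<subseteq> letters q"
      from length_upper[OF this] have "real (lamplighter_length q (state s)) \<le>
          real (card (lit_set s) + length (pos s) + 2 * card (off_path s))" by (simp only: of_nat_le_iff)
      then show "real (lamplighter_length q (state s)) \<le>
          real (card (lit_set s)) + real (length (pos s)) + 2 * real (card (off_path s))" by simp
    qed
    also have "\<dots> = expect n (\<lambda>s. real (card (lit_set s))) + expect n (\<lambda>s. real (length (pos s))) +
        2 * expect n (\<lambda>s. real (card (off_path s)))"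
      by (simp only: expect_add expect_diff expect_cmult)
    also have "\<dots> \<le> (real n * (p * (1 - 2 * nu)) + 2 * (real q + 1) / (1 - lam)) +
        (real n * (move_prob * (real q - 2)) + 2 * move_prob / (1 - lam)) +
        2 * (real n * ((1 - p) * (1 - F) * (1 / q - nu2_hat q p)) + (branch_const + 1) / (1 - lam))"
      by (intro add_mono mult_left_mono distance_upper lit_upper off_path_upper) auto
    also have "\<dots> = real n * B + C"
      unfolding B_def C_def by (simp add: distrib_left)
    finally show ?thesis .
  qed
  moreover have "B = (1 - p) * (real q - 2) / real q *
      ((real q + 1) / (real q - 1) - 2 * real q / (real q - 1) * nu2_hat q p
        + p * real q / (p * real q + real q - 2))"
  proof -
    have q: "real q \<ge> 3" using q3 by simp
    have "0 < p * real q" using q p_pos by simp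
    then have D: "p * real q + real q - 2 > 0" using q by simp
    show ?thesis
      unfolding B_def sign_lim_neg escape_eq move_prob_times using D q by (simp add: divide_simps) algebra
  qed
  ultimately show ?thesis by blast
qed

definition words :: "nat \<Rightarrow> nat option list set" where
  "words n = {s. set s \<subseteq> letters q \<and> length s = n}"

lemma finite_letters: "finite (letters q)"
  by (simp add: letters_def)

lemma finite_words: "finite (words n)"
  unfolding words_def by (rule finite_lists_length_eq[OF finite_letters])

lemma inj_emb: "inj_on emb (letters q)"
proof (rule inj_onI)
  fix x y assume "emb x = emb y"
  moreover have "switch \<noteq> ((\<lambda>_. 0), [a])" for a by (simp add: switch_def)
  ultimately show "x = y" by (cases x; cases y) (auto simp: switch_def)
qed

lemma step_law_emb:
  "x \<in> letters q \<Longrightarrow> step_law q p (emb x) = (if x = None then p else move_prob)"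
  by (cases x) (auto simp: step_law_def letters_def move_prob_def switch_def moves_def)

lemma sum_letters: "(\<Sum>x\<in>letters q. f x) = f None + (\<Sum>a<q. f (Some a))"
  by (simp add: letters_def sum.reindex)

lemma expect_as_sum:
  "expect n f = (\<Sum>s\<in>words n. (\<Prod>i<n. step_law q p (emb (s ! i))) * f s)"
proof (induction n arbitrary: f)
  case 0
  have "words 0 = {[]}" by (auto simp: words_def)
  then show ?case by simp
next
  case (Suc n)
  have words: "words (Suc n) = (\<lambda>(x, s). x # s) ` (letters q \<times> words n)"
    by (auto simp: words_def image_iff length_Suc_conv)
  have "(\<Sum>s\<in>words (Suc n). (\<Prod>i<Suc n. step_law q p (emb (s ! i))) * f s) =
      (\<Sum>(x, s)\<in>letters q \<times> words n. (\<Prod>i<Suc n. step_law q p (emb ((x # s) ! i))) * f (x # s))"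
    unfolding words by (subst sum.reindex) (auto simp: inj_on_def case_prod_beta)
  also have "\<dots> = (\<Sum>x\<in>letters q. \<Sum>s\<in>words n. (\<Prod>i<Suc n. step_law q p (emb ((x # s) ! i))) * f (x # s))"
    by (rule sum.cartesian_product[symmetric])
  also have "\<dots> = (\<Sum>x\<in>letters q. step_law q p (emb x) * expect n (\<lambda>s. f (x # s)))"
    unfolding Suc.IH prod.lessThan_Suc_shift by (simp add: sum_distrib_left mult.assoc)
  also have "\<dots> = expect (Suc n) f"
  proof -
    have "(\<Sum>x\<in>letters q. step_law q p (emb x) * expect n (\<lambda>s. f (x # s))) =
        (\<Sum>x\<in>letters q. (if x = None then p else move_prob) * expect n (\<lambda>s. f (x # s)))"
      by (intro sum.cong) (simp_all add: step_law_emb)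
    then show ?thesis unfolding sum_letters by (simp add: sum_distrib_left)
  qed
  finally show ?case by simp
qed

text \<open>
  Almost surely all increments are generators, and then \<open>\<ell>(Z\<^sub>n)\<close> equals a finite sum over words, weighted with the
  indicators of the events that the first \<open>n\<close> increments spell the word.  Independence gives the
  probabilities of these events, and boundedness by \<open>n\<close> allows to pass to the limit under the integral.
\<close>

lemma rate_as_limit_of_expectations:
  fixes M :: "'w measure" and X :: "nat \<Rightarrow> 'w \<Rightarrow> lamplighter_state" and l :: real
  assumes "prob_space M"
    and indep: "prob_space.indep_vars M (\<lambda>_. count_space (carrier lamp_group)) X {1..}"
    and law: "\<And>n g. n \<ge> 1 \<Longrightarrow> g \<in> carrier lamp_group \<Longrightarrow>
      measure M {\<omega> \<in> space M. X n \<omega> = g} = step_law q p g"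
    and rate: "AE \<omega> in M. (\<lambda>n. real (lamplighter_length q (random_walk lamp_group X n \<omega>)) / real n) \<longlonglongrightarrow> l"
  shows "(\<lambda>n. expect n (\<lambda>s. real (lamplighter_length q (state s))) / real n) \<longlonglongrightarrow> l"
proof -
  interpret prob_space M by fact
  define ev where "ev s = {\<omega> \<in> space M. \<forall>i<length s. X (Suc i) \<omega> = emb (s ! i)}" for s
  define f where "f n \<omega> = (\<Sum>s\<in>words n. real (lamplighter_length q (state s)) * indicator (ev s) \<omega>)" for n \<omega>
  have single: "{\<omega> \<in> space M. X n \<omega> = emb x} = X n -` {emb x} \<inter> space M" for n x by auto
  have meas: "{\<omega> \<in> space M. X n \<omega> = emb x} \<in> events" if "n \<ge> 1" "x \<in> letters q" for n x
  proof -
    have "random_variable (count_space (carrier lamp_group)) (X n)"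
      using indep that unfolding indep_vars_def by auto
    then show ?thesis
      unfolding single by (rule measurable_sets) (use emb_carrier[OF that(2)] in simp)
  qed
  have ev_Int: "ev s = (\<Inter>i\<in>{1..length s}. X i -` {emb (s ! (i - 1))} \<inter> space M)" if "s \<noteq> []" for s
  proof -
    have "(\<forall>i<length s. P (Suc i) (s ! i)) \<longleftrightarrow> (\<forall>i\<in>{1..length s}. P i (s ! (i - 1)))" for P
    proof
      assume *: "\<forall>i<length s. P (Suc i) (s ! i)"
      show "\<forall>i\<in>{1..length s}. P i (s ! (i - 1))"
      proof
        fix i assume "i \<in> {1..length s}"
        then show "P i (s ! (i - 1))" using * by (cases i) auto
      qed
    next
      assume *: "\<forall>i\<in>{1..length s}. P i (s ! (i - 1))"
      show "\<forall>i<length s. P (Suc i) (s ! i)"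
        using *[rule_format, of "Suc i" for i] by simp
    qed
    note this[of "\<lambda>i x. X i \<omega> = emb x" for \<omega>]
    then show ?thesis using that unfolding ev_def by (auto simp: Suc_le_eq)
  qed
  have ev_prob: "ev s \<in> events \<and> prob (ev s) = (\<Prod>i<n. step_law q p (emb (s ! i)))" if s: "s \<in> words n" for s n
  proof (cases "s = []")
    case True
    then show ?thesis using s by (simp add: ev_def words_def prob_space)
  next
    case False
    have lt: "s ! i \<in> letters q" if "i < n" for i
      using s that by (auto simp: words_def)
    have len: "length s = n" using s by (simp add: words_def)
    have "prob (ev s) = (\<Prod>i\<in>{1..n}. prob (X i -` {emb (s ! (i - 1))} \<inter> space M))"
      unfolding ev_Int[OF False] len
    proof (rule indep_varsD[OF indep])
      show "{1..n} \<noteq> {}" using False len by (cases s) auto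
      show "{emb (s ! (i - 1))} \<in> sets (count_space (carrier lamp_group))" if "i \<in> {1..n}" for i
        using emb_carrier[OF lt[of "i - 1"]] that by auto
    qed auto
    also have "\<dots> = (\<Prod>i\<in>{1..n}. step_law q p (emb (s ! (i - 1))))"
    proof (rule prod.cong)
      fix i assume "i \<in> {1..n}"
      then show "prob (X i -` {emb (s ! (i - 1))} \<inter> space M) = step_law q p (emb (s ! (i - 1)))"
        using law[of i "emb (s ! (i - 1))"] emb_carrier[OF lt[of "i - 1"]] unfolding single by auto
    qed simp
    also have "\<dots> = (\<Prod>i<n. step_law q p (emb (s ! i)))"
      by (rule prod.reindex_bij_witness[of _ Suc "\<lambda>i. i - 1"]) auto
    finally have "prob (ev s) = (\<Prod>i<n. step_law q p (emb (s ! i)))" .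
    moreover have "ev s = (\<Inter>i\<in>{1..n}. {\<omega> \<in> space M. X i \<omega> = emb (s ! (i - 1))})"
      unfolding ev_Int[OF False] len single ..
    moreover have "\<dots> \<in> events"
    proof (rule sets.finite_INT)
      show "{1..n} \<noteq> {}" using False len by (cases s) auto
      show "{\<omega> \<in> space M. X i \<omega> = emb (s ! (i - 1))} \<in> events" if "i \<in> {1..n}" for i
        using meas[of i, OF _ lt[of "i - 1"]] that by auto
    qed simp
    ultimately show ?thesis by simp
  qed
  have support: "AE \<omega> in M. \<forall>i. X (Suc i) \<omega> \<in> emb ` letters q"
    unfolding AE_all_countable
  proof
    fix i
    let ?B = "\<Union>x\<in>letters q. {\<omega> \<in> space M. X (Suc i) \<omega> = emb x}"
    have "prob ?B = (\<Sum>x\<in>letters q. prob {\<omega> \<in> space M. X (Suc i) \<omega> = emb x})"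
      using inj_emb
      by (intro finite_measure_finite_Union finite_letters)
        (auto simp: disjoint_family_on_def inj_on_def meas)
    also have "\<dots> = (\<Sum>x\<in>letters q. if x = None then p else move_prob)"
      by (intro sum.cong) (simp_all add: law emb_carrier step_law_emb)
    also have "\<dots> = 1" unfolding sum_letters using move_prob_q by (simp add: mult.commute)
    finally have "prob ?B = 1" .
    moreover have "?B \<in> events"
      using finite_letters meas by (intro sets.finite_UN) auto
    ultimately have "AE \<omega> in M. \<omega> \<in> ?B" using prob_eq_1 by blast
    then show "AE \<omega> in M. X (Suc i) \<omega> \<in> emb ` letters q" by eventually_elim auto
  qed
  have f_eq: "\<exists>s\<in>words n. f n \<omega> = real (lamplighter_length q (state s)) \<and> random_walk lamp_group X n \<omega> = state s"
    if \<omega>: "\<omega> \<in> space M" "\<forall>i. X (Suc i) \<omega> \<in> emb ` letters q" for n \<omega>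
  proof -
    obtain x where x: "\<And>i. x i \<in> letters q" "\<And>i. X (Suc i) \<omega> = emb (x i)"
      using \<omega>(2) unfolding image_iff by metis
    define t where "t n = map x [0..<n]" for n
    have t: "t n \<in> words n" for n using x by (auto simp: words_def t_def)
    have "random_walk lamp_group X n \<omega> = state (t n)"
    proof (induction n)
      case (Suc n)
      have "set (t n) \<subseteq> letters q" using t[of n] by (simp add: words_def)
      then show ?case using Suc x by (simp add: state_snoc t_def)
    qed (simp add: t_def state_Nil)
    moreover have "indicator (ev s) \<omega> = (if s = t n then 1 else 0 :: real)" if s: "s \<in> words n" for s
    proof -
      have "\<omega> \<in> ev s \<longleftrightarrow> (\<forall>i<n. emb (x i) = emb (s ! i))"
        using s \<omega> x by (simp add: ev_def words_def)
      also have "\<dots> \<longleftrightarrow> (\<forall>i<n. x i = s ! i)"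
      proof -
        have "s ! i \<in> letters q" if "i < n" for i using s that by (auto simp: words_def)
        then show ?thesis using inj_emb x(1) by (auto simp: inj_on_eq_iff)
      qed
      also have "\<dots> \<longleftrightarrow> s = t n"
        using s by (auto simp: words_def t_def list_eq_iff_nth_eq)
      finally show ?thesis by (simp add: indicator_def)
    qed
    then have "f n \<omega> = (\<Sum>s\<in>words n. if s = t n then real (lamplighter_length q (state s)) else 0)"
      unfolding f_def by (intro sum.cong) auto
    then have "f n \<omega> = real (lamplighter_length q (state (t n)))"
      using t[of n] by (simp add: finite_words)
    ultimately show ?thesis using t by blast
  qed
  have f_meas: "f n \<in> borel_measurable M" for n
    unfolding f_def using ev_prob
    by (intro borel_measurable_sum borel_measurable_times borel_measurable_const borel_measurable_indicator) auto
  have f_int: "integral\<^sup>L M (\<lambda>\<omega>. f n \<omega> / real n) = expect n (\<lambda>s. real (lamplighter_length q (state s))) / real n" for n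
  proof -
    have "integrable M (indicator (ev s) :: 'w \<Rightarrow> real)" if "s \<in> words n" for s
      using ev_prob[OF that] by (intro integrable_real_indicator) (auto simp: emeasure_eq_measure)
    then have "integral\<^sup>L M (f n) = (\<Sum>s\<in>words n. real (lamplighter_length q (state s)) * prob (ev s))"
      unfolding f_def using ev_prob by (subst Bochner_Integration.integral_sum) auto
    also have "\<dots> = (\<Sum>s\<in>words n. (\<Prod>i<n. step_law q p (emb (s ! i))) * real (lamplighter_length q (state s)))"
      using ev_prob by (intro sum.cong) auto
    also have "\<dots> = expect n (\<lambda>s. real (lamplighter_length q (state s)))"
      by (rule expect_as_sum[symmetric])
    finally show ?thesis by simp
  qed
  have "(\<lambda>n. integral\<^sup>L M (\<lambda>\<omega>. f n \<omega> / real n)) \<longlonglongrightarrow> integral\<^sup>L M (\<lambda>_. l)"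
  proof (rule integral_dominated_convergence)
    show "AE \<omega> in M. (\<lambda>n. f n \<omega> / real n) \<longlonglongrightarrow> l"
      using rate support AE_space
    proof eventually_elim
      case (elim \<omega>)
      have "f n \<omega> = real (lamplighter_length q (random_walk lamp_group X n \<omega>))" for n
        using f_eq[OF elim(3,2), of n] by auto
      then show ?case using elim(1) by simp
    qed
    show "AE \<omega> in M. norm (f n \<omega> / real n) \<le> 1" for n
      using support AE_space
    proof eventually_elim
      case (elim \<omega>)
      obtain s where s: "s \<in> words n" "f n \<omega> = real (lamplighter_length q (state s))"
        using f_eq[OF elim(2,1), of n] by blast
      have "lamplighter_length q (state s) \<le> n" using length_le[of s] s(1) by (simp add: words_def)
      then show ?case using s by (auto simp: divide_le_eq)
    qed
  qed (use f_meas in auto)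
  then show ?thesis unfolding f_int by (simp add: prob_space)
qed

end

theorem corollary3p8:
  fixes q :: nat and p L :: real
    and M :: "'w measure" and X :: "nat \<Rightarrow> 'w \<Rightarrow> lamplighter_state"
  assumes "q \<ge> 3" and "0 < p" and "p < 1"
    and "prob_space M"
    and indep: "prob_space.indep_vars M
      (\<lambda>_. count_space (carrier (tree_lamplighter q))) X {1..}"
    and law: "\<And>n g. n \<ge> 1 \<Longrightarrow> g \<in> carrier (tree_lamplighter q) \<Longrightarrow>
      measure M {\<omega> \<in> space M. X n \<omega> = g} = step_law q p g"
    and rate: "AE \<omega> in M.
      (\<lambda>n. real (lamplighter_length q (random_walk (tree_lamplighter q) X n \<omega>)) / real n)
        \<longlonglongrightarrow> L"
  shows "L \<ge> (1 - p) * (real q - 2) / real q *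
      ((real q - 2 + 2 * p * (real q + 1)) / (p * real q + real q - 2))
    \<and> L \<le> (1 - p) * (real q - 2) / real q *
      ((real q + 1) / (real q - 1) - 2 * real q / (real q - 1) * nu2_hat q p
        + p * real q / (p * real q + real q - 2))"
proof -
  interpret lamplighter_walk q p using assms(1-3) by unfold_locales
  define e where "e n = expect n (\<lambda>s. real (lamplighter_length q (state s)))" for n
  have lim: "(\<lambda>n. e n / real n) \<longlonglongrightarrow> L"
    unfolding e_def by (rule rate_as_limit_of_expectations[OF assms(4) indep law rate])
  have "A \<le> L" if "\<forall>n. real n * A - C \<le> e n" for A C
  proof (rule LIMSEQ_le[OF _ lim])
    show "(\<lambda>n. A - C / real n) \<longlonglongrightarrow> A"
      using tendsto_diff[OF tendsto_const lim_const_over_n[of C]] by simp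
    show "\<exists>N. \<forall>n\<ge>N. A - C / real n \<le> e n / real n"
    proof (intro exI[of _ 1] allI impI)
      fix n :: nat assume "1 \<le> n"
      then show "A - C / real n \<le> e n / real n"
        using divide_right_mono[OF that[rule_format, of n], of "real n"]
        by (simp add: diff_divide_distrib)
    qed
  qed
  moreover have "L \<le> B" if "\<forall>n. e n \<le> real n * B + C" for B C
  proof (rule LIMSEQ_le[OF lim])
    show "(\<lambda>n. B + C / real n) \<longlonglongrightarrow> B"
      using tendsto_add[OF tendsto_const lim_const_over_n[of C]] by simp
    show "\<exists>N. \<forall>n\<ge>N. e n / real n \<le> B + C / real n"
    proof (intro exI[of _ 1] allI impI)
      fix n :: nat assume "1 \<le> n"
      then show "e n / real n \<le> B + C / real n"
        using divide_right_mono[OF that[rule_format, of n], of "real n"]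
        by (simp add: add_divide_distrib)
    qed
  qed
  ultimately show ?thesis
    using expected_length_lower expected_length_upper unfolding e_def by blast
qed

end
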